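(* Assume $Y \sim \mathrm{N}(0, \Sigma(\psi))$ (the linear mixed model with known $\beta = 0$). For any $t \in \mathbb{R}$, any $\psi \in \mathbb{P}$ for which $\mathcal{I}(\psi)$ is invertible, and any $v \in \mathbb{S}^{r-1}$ such that $\tilde{v} = \mathcal{I}(\psi)^{-1/2} v \neq 0$ and $a(\tilde{v}, \psi)^2 < 1/8$, it holds that \[ \vert g(t; v, \psi) - \phi(t)\vert \leq 0.14\left(4 + \frac{0.29}{\{1 - 8a(\tilde{v}, \psi)^2\}^2}\right) a(\tilde{v}, \psi). \]
   Context: Model: $Z \in \mathbb{R}^{n\times q}$ is a non-stochastic matrix. For $\psi = [\psi_1,\dots,\psi_r]^{\mathsf T} \in \mathbb{R}^r$, $\Psi(\psi) \in \mathbb{R}^{q\times q}$ is a symmetric matrix each of whose elements is either known to be zero or equal to one of $\psi_1,\dots,\psi_{r-1}$; thus $\Psi(\psi) = \sum_{j=1}^{r}\psi_j H_j$, where $H_j = \partial \Psi/\partial\psi_j$ has entries zero and one, $H_j\neq 0$ for $j<r$, and $H_r = 0$. For any $v\in\mathbb{R}^r$ (not only elements of the parameter set), $\Psi(v) = \sum_j v_j H_j$ and $\Sigma(v) = Z\Psi(v)Z^{\mathsf T} + v_r I_n$. The parameter set is $\mathbb{P} = \{\psi\in\mathbb{R}^r : \Psi(\psi) \geq 0,\ \psi_r>0\}$, where $\geq 0$ means positive semi-definite. Score and information: for $\psi \in \mathbb{P}$ let $A_j(\psi) = \Sigma(\psi)^{-1/2}\{\partial\Sigma(\psi)/\partial\psi_j\}\Sigma(\psi)^{-1/2}$,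 so $A_j = \Sigma^{-1/2}ZH_jZ^{\mathsf T}\Sigma^{-1/2}$ for $j<r$ and $A_r=\Sigma^{-1}$. With $R=\Sigma(\psi)^{-1/2}Y$, the score $S(\psi)\in\mathbb{R}^r$ (gradient in $\psi$ of the log-likelihood) has elements $S_j(\psi)=\frac12\{R^{\mathsf T}A_jR-\mathrm{tr}(A_j)\}$, and the Fisher information is the $r\times r$ matrix $\mathcal{I}(\psi)$ with elements $\mathcal{I}_{ij}(\psi)=\mathrm{tr}(A_iA_j)/2$. When $\mathcal{I}(\psi)$ is invertible, $W^S(\psi)=\mathcal{I}(\psi)^{-1/2}S(\psi)$ (symmetric square root). Notation: $\|\cdot\|$ is the Euclidean norm of vectors and the spectral norm of matrices, $\|\cdot\|_F$ the Frobenius norm; $\mathbb{S}^{r-1}=\{v\in\mathbb{R}^r:\|v\|=1\}$. For $v\in\mathbb{R}^r$, $\psi\in\mathbb{P}$, $A(v,\psi)=\sum_{j=1}^r v_jA_j(\psi)=\Sigma(\psi)^{-1/2}\Sigma(v)\Sigma(\psi)^{-1/2}$; $a(v,\psi)=\|A(v,\psi)\|/\|A(v,\psi)\|_F$ if $\|A(v,\psi)\|_F>0$ and $a(v,\psi)=1$ otherwise. $g(\cdot;v,\psi)$ is the density of $v^{\mathsf T}W^S(\psi)$ when $\psi$ is the true parameter, and $\phi$ is the standard normal density. *)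

theory Defs
  imports "HOL-Probability.Probability"
begin

subsection \<open>Matrices\<close>

definition pos_semidef :: "real ^ 'm ^ 'm \<Rightarrow> bool" where
  "pos_semidef M \<longleftrightarrow> transpose M = M \<and> (\<forall>x. 0 \<le> x \<bullet> (M *v x))"

text \<open>The symmetric positive semi-definite square root; meaningful for positive
  semi-definite arguments only.\<close>

definition mat_sqrt :: "real ^ 'm ^ 'm \<Rightarrow> real ^ 'm ^ 'm" where
  "mat_sqrt M = (THE S. pos_semidef S \<and> S ** S = M)"

definition mat_inv_sqrt :: "real ^ 'm ^ 'm \<Rightarrow> real ^ 'm ^ 'm" where
  "mat_inv_sqrt M = matrix_inv (mat_sqrt M)"

definition spectral_norm :: "real ^ 'n ^ 'm \<Rightarrow> real" where
  "spectral_norm M = onorm (\<lambda>x. M *v x)"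

text \<open>The library norm on \<open>real ^ 'n ^ 'm\<close> (a vector of row vectors) is the Frobenius norm.\<close>

definition frobenius_norm :: "real ^ 'n ^ 'm \<Rightarrow> real" where
  "frobenius_norm M = norm M"

lemma frobenius_norm_eq:
  "frobenius_norm M = sqrt (\<Sum>i\<in>UNIV. \<Sum>j\<in>UNIV. (M $ i $ j)\<^sup>2)"
  by (simp add: frobenius_norm_def norm_vec_def L2_set_def sum_nonneg)

subsection \<open>The covariance model\<close>

text \<open>The index type \<open>'r\<close> plays the role of \<open>{1,\<dots>,r}\<close>, and \<open>e :: 'r\<close> that of the last index
  \<open>r\<close>, which belongs to the error variance. The structure of \<open>\<Psi>\<close> is a pattern \<open>P\<close>: the entry at
  \<open>(a, b)\<close> is known to be zero if \<open>P a b = None\<close>, and is the parameter \<open>\<psi>\<^sub>j\<close> if \<open>P a b = Some j\<close>.\<close>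

definition covariance_pattern :: "('q \<Rightarrow> 'q \<Rightarrow> 'r option) \<Rightarrow> 'r \<Rightarrow> bool" where
  "covariance_pattern P e \<longleftrightarrow>
     (\<forall>a b. P a b = P b a) \<and>
     (\<forall>a b. P a b \<noteq> Some e) \<and>
     (\<forall>j. j \<noteq> e \<longrightarrow> (\<exists>a b. P a b = Some j))"

definition H_mat :: "('q \<Rightarrow> 'q \<Rightarrow> 'r option) \<Rightarrow> 'r \<Rightarrow> real ^ 'q ^ 'q" where
  "H_mat P j = (\<chi> a b. if P a b = Some j then 1 else 0)"

definition Psi :: "('q \<Rightarrow> 'q \<Rightarrow> 'r::finite option) \<Rightarrow> real ^ 'r \<Rightarrow> real ^ 'q ^ 'q" where
  "Psi P v = (\<Sum>j\<in>UNIV. v $ j *\<^sub>R H_mat P j)"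

definition cov ::
  "real ^ 'q ^ 'n \<Rightarrow> ('q::finite \<Rightarrow> 'q \<Rightarrow> 'r::finite option) \<Rightarrow> 'r \<Rightarrow> real ^ 'r \<Rightarrow> real ^ 'n ^ 'n" where
  "cov Z P e v = Z ** Psi P v ** transpose Z + v $ e *\<^sub>R mat 1"

definition param_set :: "('q::finite \<Rightarrow> 'q \<Rightarrow> 'r::finite option) \<Rightarrow> 'r \<Rightarrow> (real ^ 'r) set" where
  "param_set P e = {\<psi>. pos_semidef (Psi P \<psi>) \<and> \<psi> $ e > 0}"

lemma Psi_entry: "Psi P v $ a $ b = (case P a b of None \<Rightarrow> 0 | Some j \<Rightarrow> v $ j)"
proof -
  have "Psi P v $ a $ b = (\<Sum>j\<in>UNIV. if P a b = Some j then v $ j else 0)"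
    by (simp add: Psi_def H_mat_def if_distrib[of "\<lambda>x. _ * x"] cong: if_cong)
  also have "\<dots> = (case P a b of None \<Rightarrow> 0 | Some j \<Rightarrow> v $ j)"
    by (cases "P a b") auto
  finally show ?thesis .
qed

subsection \<open>Score and Fisher information\<close>

definition A_mat ::
  "real ^ 'q ^ 'n \<Rightarrow> ('q::finite \<Rightarrow> 'q \<Rightarrow> 'r::finite option) \<Rightarrow> 'r \<Rightarrow> real ^ 'r \<Rightarrow> 'r
    \<Rightarrow> real ^ 'n ^ 'n" where
  "A_mat Z P e \<psi> j =
     mat_inv_sqrt (cov Z P e \<psi>) ** frechet_derivative (cov Z P e) (at \<psi>) (axis j 1)
       ** mat_inv_sqrt (cov Z P e \<psi>)"

definition score ::
  "real ^ 'q ^ 'n \<Rightarrow> ('q::finite \<Rightarrow> 'q \<Rightarrow> 'r::finite option) \<Rightarrow> 'r \<Rightarrow> real ^ 'r \<Rightarrow> real ^ 'n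
    \<Rightarrow> real ^ 'r" where
  "score Z P e \<psi> y =
     (let R = mat_inv_sqrt (cov Z P e \<psi>) *v y
      in \<chi> j. 1 / 2 * (R \<bullet> (A_mat Z P e \<psi> j *v R) - trace (A_mat Z P e \<psi> j)))"

definition fisher_info ::
  "real ^ 'q ^ 'n \<Rightarrow> ('q::finite \<Rightarrow> 'q \<Rightarrow> 'r::finite option) \<Rightarrow> 'r \<Rightarrow> real ^ 'r
    \<Rightarrow> real ^ 'r ^ 'r" where
  "fisher_info Z P e \<psi> = (\<chi> i j. trace (A_mat Z P e \<psi> i ** A_mat Z P e \<psi> j) / 2)"

definition std_score ::
  "real ^ 'q ^ 'n \<Rightarrow> ('q::finite \<Rightarrow> 'q \<Rightarrow> 'r::finite option) \<Rightarrow> 'r \<Rightarrow> real ^ 'r \<Rightarrow> real ^ 'n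
    \<Rightarrow> real ^ 'r" where
  "std_score Z P e \<psi> y = mat_inv_sqrt (fisher_info Z P e \<psi>) *v score Z P e \<psi> y"

definition A_comb ::
  "real ^ 'q ^ 'n \<Rightarrow> ('q::finite \<Rightarrow> 'q \<Rightarrow> 'r::finite option) \<Rightarrow> 'r \<Rightarrow> real ^ 'r \<Rightarrow> real ^ 'r
    \<Rightarrow> real ^ 'n ^ 'n" where
  "A_comb Z P e v \<psi> = (\<Sum>j\<in>UNIV. v $ j *\<^sub>R A_mat Z P e \<psi> j)"

definition a_ratio ::
  "real ^ 'q ^ 'n \<Rightarrow> ('q::finite \<Rightarrow> 'q \<Rightarrow> 'r::finite option) \<Rightarrow> 'r \<Rightarrow> real ^ 'r \<Rightarrow> real ^ 'r
    \<Rightarrow> real" where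
  "a_ratio Z P e v \<psi> =
     (if frobenius_norm (A_comb Z P e v \<psi>) > 0
      then spectral_norm (A_comb Z P e v \<psi>) / frobenius_norm (A_comb Z P e v \<psi>)
      else 1)"

lemma linear_Psi: "linear (Psi P)"
  by (rule linearI) (simp_all add: Psi_def scaleR_add_left sum.distrib scaleR_sum_right)

lemma linear_cov: "linear (cov Z P e)"
proof (rule linearI)
  fix v w show "cov Z P e (v + w) = cov Z P e v + cov Z P e w"
    by (simp add: cov_def linear_add[OF linear_Psi] matrix_add_ldistrib scaleR_add_left
        matrix_matrix_mult_def vec_eq_iff distrib_right distrib_left sum.distrib)
next
  fix c v show "cov Z P e (c *\<^sub>R v) = c *\<^sub>R cov Z P e v"
    by (simp add: cov_def linear_scale[OF linear_Psi] matrix_matrix_mult_def vec_eq_iff distrib_left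
        sum_distrib_left sum_distrib_right mult_ac)
qed

lemma frechet_derivative_cov:
  "frechet_derivative (cov Z P e) (at \<psi>) (axis j 1) =
     Z ** H_mat P j ** transpose Z + (if j = e then mat 1 else 0)"
proof -
  have "frechet_derivative (cov Z P e) (at \<psi>) = cov Z P e"
    by (rule frechet_derivative_at[symmetric])
      (simp add: bounded_linear_imp_has_derivative linear_conv_bounded_linear[symmetric] linear_cov)
  moreover have "Psi P (axis j 1) = H_mat P j"
    by (simp add: Psi_def axis_def if_distrib[of "\<lambda>x. x *\<^sub>R _"] cong: if_cong)
  ultimately show ?thesis
    by (simp add: cov_def axis_def)
qed

subsection \<open>Densities\<close>

definition mvn_density :: "real ^ 'n \<Rightarrow> real ^ 'n ^ 'n \<Rightarrow> real ^ 'n \<Rightarrow> real" where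
  "mvn_density \<mu> V y =
     exp (- ((y - \<mu>) \<bullet> (matrix_inv V *v (y - \<mu>))) / 2) / sqrt ((2 * pi) ^ CARD('n) * det V)"

text \<open>A density is determined only up to null sets; evaluating it at a point refers to the
  continuous version. Nonnegativity is required because \<open>ennreal\<close> truncates negative values.\<close>

definition continuous_density :: "'a measure \<Rightarrow> ('a \<Rightarrow> real) \<Rightarrow> (real \<Rightarrow> real) \<Rightarrow> bool" where
  "continuous_density M X g \<longleftrightarrow>
     continuous_on UNIV g \<and> (\<forall>t. 0 \<le> g t) \<and> distributed M lborel X (\<lambda>t. ennreal (g t))"

end

theory Submission
  imports Defs "HOL-Real_Asymp.Real_Asymp"
begin

text \<open>
  Put \<open>A = A(v', \<psi>)\<close> and \<open>R = \<Sigma>(\<psi>)^(-1/2) Y\<close>, a standard normal vector. Since \<open>v \<bullet> W = v' \<bullet> S\<close>, the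
  statistic is the quadratic form \<open>(R \<bullet> A R - tr A) / 2\<close>. In an orthonormal eigenbasis of the symmetric
  matrix \<open>A\<close> it becomes \<open>\<Sum>\<^sub>i l\<^sub>i (X\<^sub>i^2 - 1) / 2\<close> with independent standard normal \<open>X\<^sub>i\<close>. The factor
  \<open>I(\<psi>)^(-1/2)\<close> in \<open>v'\<close> is there to make the variance one, that is, \<open>\<Sum>\<^sub>i l\<^sub>i^2 = 2\<close>, the squared Frobenius
  norm of \<open>A\<close>; hence \<open>a = \<parallel>A\<parallel> / sqrt 2\<close> and every \<open>\<bar>l\<^sub>i\<bar>\<close> is at most \<open>sqrt 2 a\<close>. A small \<open>a\<close> says that
  no single summand dominates, and the claim is a local limit theorem with an explicit rate.

  The characteristic function of the statistic is \<open>\<Phi>(s) = \<Prod>\<^sub>i exp (L (l\<^sub>i s))\<close> with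
  \<open>L(x) = - i x / 2 - Ln (1 - i x) / 2\<close> (\<open>char_quadratic_form\<close>). Three facts about it carry the proof.
  \<^item> For all real \<open>x\<close>, \<open>L(x)\<close> differs from \<open>- x^2 / 4\<close> by at most \<open>\<bar>x\<bar>^3 / 6\<close>
    (\<open>log_char_half_square_approx\<close>). Summing over \<open>i\<close>, the exponents of \<open>\<Phi>(s)\<close> and of \<open>exp (- s^2 / 2)\<close>
    differ by at most \<open>sqrt 2 a \<bar>s\<bar>^3 / 3\<close>, and convexity of the exponential function turns this into
    \<open>\<bar>\<Phi>(s) - exp (- s^2 / 2)\<bar> \<le> sqrt 2 a \<bar>s\<bar>^3 (\<bar>\<Phi>(s)\<bar> + exp (- s^2 / 2)) / 6\<close>
    (\<open>quad_char_normal_diff_le\<close>).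
  \<^item> The modulus \<open>\<bar>\<Phi>(s)\<bar> = \<Prod>\<^sub>i (1 + l\<^sub>i^2 s^2)^(-1/4)\<close> is, for given \<open>\<Sum>\<^sub>i l\<^sub>i^2\<close>, largest when the mass is
    concentrated on as few eigenvalues as possible. By concavity of the logarithm it is at most
    \<open>(1 + 2 a^2 s^2)^(- 1 / (4 a^2))\<close> (\<open>norm_quad_char_le\<close>).
  \<^item> The condition \<open>a^2 < 1/8\<close> is exactly what makes \<open>\<bar>s\<bar>^3\<close> times this bound integrable; the integral is
    \<open>4 / ((1 - 4 a^2) (1 - 8 a^2))\<close> (\<open>has_bochner_integral_abs_cube_powr\<close>), while the Gaussian term
    contributes \<open>4\<close>.

  As \<open>\<Phi>\<close> is integrable, Fourier inversion (\<open>density_inverse_fourier\<close>) provides a continuous density,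
  and its distance to the normal density is at most
  \<open>1 / (2 \<pi>)\<close> times the integral of \<open>\<bar>\<Phi>(s) - exp (- s^2 / 2)\<bar>\<close>, hence at most
  \<open>sqrt 2 a / (3 \<pi>) (1 + 1 / ((1 - 4 a^2) (1 - 8 a^2)))\<close>. In terms of \<open>d = 1 - 8 a^2\<close>, comparing this with
  the stated bound amounts to the positivity of a cubic polynomial on \<open>0 < d < 1\<close>
  (\<open>density_bound_constants\<close>).

  Two preparations enter. The matrix square roots are definite
  descriptions, so they denote something only because a positive semi-definite matrix has exactly one
  positive semi-definite square root; this, like the diagonalization of \<open>A\<close>, rests on the spectral theorem
  for symmetric matrices. And the law of \<open>R\<close> is found without computing a determinant: a linear bijection
  multiplies Lebesgue measure by some constant, and the constant is then forced by total mass one.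
\<close>

section \<open>Spectral theorem and square roots of symmetric matrices\<close>

text \<open>A semi-definite form attains its minimum \<open>0\<close> at \<open>x\<close>, so its first-order variation in every
  direction \<open>y\<close> vanishes.\<close>

lemma psd_form_null_vector:
  fixes f :: "'a::euclidean_space \<Rightarrow> 'a"
  assumes lin: "linear f" and sym: "\<And>x y. x \<bullet> f y = f x \<bullet> y"
    and S: "subspace S" and psd: "\<And>x. x \<in> S \<Longrightarrow> 0 \<le> x \<bullet> f x"
    and x: "x \<in> S" "x \<bullet> f x = 0" and y: "y \<in> S"
  shows "y \<bullet> f x = 0"
proof -
  let ?b = "y \<bullet> f x" and ?q = "y \<bullet> f y"
  have q: "0 \<le> ?q" using psd y by simp
  have expand: "0 \<le> 2 * t * ?b + t\<^sup>2 * ?q" for t :: real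
  proof -
    have "x + t *\<^sub>R y \<in> S" using S x y by (simp add: subspace_add subspace_scale)
    then have "0 \<le> (x + t *\<^sub>R y) \<bullet> f (x + t *\<^sub>R y)" by (rule psd)
    also have "\<dots> = 2 * t * ?b + t\<^sup>2 * ?q"
      using x(2) sym[of x y]
      by (simp add: linear_add[OF lin] linear_scale[OF lin] inner_simps power2_eq_square inner_commute)
    finally show ?thesis .
  qed
  show ?thesis
  proof (rule ccontr)
    assume b: "?b \<noteq> 0"
    \<comment> \<open>The vertex \<open>- ?b / ?q\<close> of the parabola, with the denominator shifted because \<open>?q\<close> may be zero.\<close>
    define t where "t = - ?b / (?q + 1)"
    have "2 * t * ?b + t\<^sup>2 * ?q = - (?b\<^sup>2 * (?q + 2)) / (?q + 1)\<^sup>2"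
      using q unfolding t_def by (simp add: divide_simps) (simp add: algebra_simps power2_eq_square)
    also have "\<dots> < 0" using q b by (simp add: divide_neg_pos)
    finally show False using expand[of t] by simp
  qed
qed

text \<open>A maximizer \<open>x\<close> of the Rayleigh quotient over the unit sphere of \<open>S\<close>, with maximum \<open>m\<close>, is a null
  vector of the form \<open>m (y \<bullet> y) - y \<bullet> f y\<close>, which is non-negative on \<open>S\<close>. Invariance of \<open>S\<close> puts
  \<open>m x - f x\<close> itself among the directions along which the variation vanishes.\<close>

lemma self_adjoint_eigenvector_in_subspace:
  fixes f :: "'a::euclidean_space \<Rightarrow> 'a"
  assumes lin: "linear f" and sym: "\<And>x y. x \<bullet> f y = f x \<bullet> y"
    and S: "subspace S" and inv: "\<And>x. x \<in> S \<Longrightarrow> f x \<in> S" and nz: "S \<noteq> {0}"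
  obtains x m where "x \<in> S" "norm x = 1" "f x = m *\<^sub>R x"
proof -
  have cont: "continuous_on T f" for T
    using lin by (simp add: linear_continuous_on linear_conv_bounded_linear)
  let ?K = "S \<inter> sphere 0 1"
  have "compact ?K" by (simp add: S closed_subspace closed_Int_compact)
  moreover have "?K \<noteq> {}"
  proof -
    obtain z where z: "z \<in> S" "z \<noteq> 0" using nz subspace_0[OF S] by auto
    then have "z /\<^sub>R norm z \<in> ?K" using S by (simp add: subspace_scale)
    then show ?thesis by blast
  qed
  moreover have "continuous_on ?K (\<lambda>x. x \<bullet> f x)" by (intro continuous_intros cont)
  ultimately have "\<exists>x\<in>?K. \<forall>y\<in>?K. y \<bullet> f y \<le> x \<bullet> f x" by (rule continuous_attains_sup)
  then obtain x where x: "x \<in> ?K" and max: "\<And>y. y \<in> ?K \<Longrightarrow> y \<bullet> f y \<le> x \<bullet> f x" by auto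
  define m where "m = x \<bullet> f x"
  have nx: "x \<bullet> x = 1" using x by (simp add: norm_eq_1)
  define h where "h y = m *\<^sub>R y - f y" for y
  have lh: "linear h" unfolding h_def
    by (intro linearI) (simp_all add: linear_add[OF lin] linear_scale[OF lin] algebra_simps)
  have "h x \<bullet> h x = 0"
  proof (rule psd_form_null_vector[OF lh _ S])
    show "y \<bullet> h z = h y \<bullet> z" for y z 
      using sym[of y z] by (simp add: h_def inner_simps)
    show "x \<bullet> h x = 0" using nx by (simp add: h_def inner_simps m_def)
    show "0 \<le> y \<bullet> h y" if "y \<in> S" for y
    proof (cases "y = 0")
      case False
      have "y /\<^sub>R norm y \<in> ?K" using S that False by (simp add: subspace_scale)
      from max[OF this] have "(y \<bullet> f y) / (norm y)\<^sup>2 \<le> m"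
        by (simp add: linear_scale[OF lin] m_def power2_eq_square divide_inverse mult_ac)
      then have "y \<bullet> f y \<le> m * (norm y)\<^sup>2" using False by (simp add: divide_simps)
      then show ?thesis by (simp add: h_def inner_simps power2_norm_eq_inner)
    qed simp
    show "x \<in> S" using x by simp
    show "h x \<in> S" using x S inv by (simp add: h_def subspace_diff subspace_scale)
  qed
  then have "f x = m *\<^sub>R x" by (simp add: h_def)
  then show ?thesis using that x by auto
qed

text \<open>Take an orthonormal set of eigenvectors of maximal size. Its orthogonal complement is invariant, so if
  it were non-trivial it would contain one more eigenvector.\<close>

lemma self_adjoint_eigenbasis:
  fixes f :: "'a::euclidean_space \<Rightarrow> 'a"
  assumes lin: "linear f" and sym: "\<And>x y. x \<bullet> f y = f x \<bullet> y"
  obtains B where "card B = DIM('a)" "finite B" "pairwise orthogonal B"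
    "\<forall>x\<in>B. norm x = 1" "\<forall>x\<in>B. \<exists>m. f x = m *\<^sub>R x"
proof -
  define good where "good B \<longleftrightarrow> pairwise orthogonal B \<and> (\<forall>x\<in>B. norm x = 1 \<and> (\<exists>m. f x = m *\<^sub>R x))"
    for B :: "'a set"
  have indep: "independent B" if "good B" for B
    using that unfolding good_def by (intro pairwise_orthogonal_independent) auto
  have bound: "card B \<le> DIM('a)" if "good B" for B
    using independent_bound[OF indep[OF that]] by simp
  have "good {}" by (simp add: good_def)
  then have "\<exists>B. good B \<and> (\<forall>C. good C \<longrightarrow> card C \<le> card B)"
    by (rule ex_has_greatest_nat[where b = "Suc DIM('a)"]) (simp add: bound less_Suc_eq_le)
  then obtain B where B: "good B" and max: "\<And>C. good C \<Longrightarrow> card C \<le> card B" by auto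
  have fin: "finite B" using independent_bound[OF indep[OF B]] by simp
  let ?S = "{y. \<forall>x\<in>span B. orthogonal x y}"
  have "?S = {0}"
  proof (rule ccontr)
    assume nz: "?S \<noteq> {0}"
    have sub: "subspace ?S" by (rule subspace_orthogonal_to_vectors)
    have inv: "f y \<in> ?S" if "y \<in> ?S" for y
    proof -
      have ev: "f x \<in> span B" if "x \<in> span B" for x
        using that
      proof (induction rule: span_induct_alt)
        case base then show ?case using linear_0[OF lin] by (simp add: span_zero)
      next
        case (step c b z)
        obtain m where "f b = m *\<^sub>R b" using B step by (auto simp: good_def)
        then show ?case using step
          by (simp add: linear_add[OF lin] linear_scale[OF lin] span_add span_scale span_base)
      qed
      show ?thesis using that ev sym by (auto simp: orthogonal_def)
    qed
    obtain x m where x: "x \<in> ?S" "norm x = 1" "f x = m *\<^sub>R x"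
      using self_adjoint_eigenvector_in_subspace[OF lin sym sub inv nz] by blast
    have orth: "orthogonal b x" if "b \<in> B" for b using x that by (simp add: span_base)
    have "x \<notin> B"
    proof
      assume "x \<in> B"
      then have "x \<bullet> x = 0" using orth[of x] by (simp add: orthogonal_def)
      then show False using x(2) by simp
    qed
    have "good (insert x B)"
      using B x orth by (auto simp: good_def pairwise_insert orthogonal_commute)
    from max[OF this] show False using \<open>x \<notin> B\<close> fin by simp
  qed
  then have perp: "x = 0" if "\<And>y. y \<in> span B \<Longrightarrow> orthogonal x y" for x
    using that by (auto simp: orthogonal_commute)
  have "span B = UNIV"
  proof (rule ccontr)
    assume "span B \<noteq> UNIV"
    then have "span B \<subset> span UNIV" by auto
    then obtain x where "x \<noteq> 0" "\<And>y. y \<in> span B \<Longrightarrow> orthogonal x y"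
      by (rule orthogonal_to_subspace_exists_gen) blast
    then show False using perp by blast
  qed
  then have "card B = DIM('a)"
    using dim_span_eq_card_independent[OF indep[OF B]] dim_UNIV by simp
  then show ?thesis using that[of B] B fin by (auto simp: good_def)
qed


(* Keeps \<open>transpose Q *v x\<close> from being rewritten to \<open>x v* Q\<close>, so that associativity applies. *)
declare transpose_matrix_vector [simp del]

lemma symmetric_inner_commute: "transpose (A :: real ^ 'n ^ 'n) = A \<Longrightarrow> x \<bullet> (A *v y) = (A *v x) \<bullet> y"
  by (metis dot_lmul_matrix vector_transpose_matrix)

lemma inner_matrix_vector_transpose: "x \<bullet> (transpose A *v y) = (A *v x) \<bullet> (y :: real ^ 'n)"
  by (metis dot_lmul_matrix inner_commute transpose_matrix_vector)

lemma matrix_inv_cancel: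
  assumes "invertible (A :: 'a::semiring_1 ^ 'n ^ 'm)"
  shows "A ** matrix_inv A = mat 1" "matrix_inv A ** A = mat 1"
  using someI_ex[OF assms[unfolded invertible_def]] by (simp_all add: matrix_inv_def)

text \<open>Symmetric matrices are written as \<open>transpose Q ** diag_mat d ** Q\<close> with the eigenvectors as the rows of
  \<open>Q\<close>, so that \<open>Q *v x\<close> lists the coordinates of \<open>x\<close> in the eigenbasis.\<close>

definition diag_mat :: "('n \<Rightarrow> real) \<Rightarrow> real ^ 'n ^ 'n" where
  "diag_mat d = (\<chi> i j. if i = j then d i else 0)"

lemma diag_mat_vec: "diag_mat d *v x = (\<chi> i. d i * x $ i)"
  by (simp add: diag_mat_def matrix_vector_mult_def vec_eq_iff if_distrib[of "\<lambda>c. c * _"] cong: if_cong)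

lemma diag_mat_mult: "diag_mat c ** diag_mat d = diag_mat (\<lambda>i. c i * d i)"
  by (simp add: diag_mat_def matrix_matrix_mult_def vec_eq_iff if_distrib[of "\<lambda>c. c * _"] cong: if_cong)

lemma transpose_diag_mat: "transpose (diag_mat d) = diag_mat d"
  by (simp add: diag_mat_def transpose_def vec_eq_iff)

lemma trace_diag_mat: "trace (diag_mat d) = (\<Sum>i\<in>UNIV. d i)"
  by (simp add: diag_mat_def trace_def)

lemma orthogonal_matrix_cancel:
  assumes "orthogonal_matrix (Q :: real ^ 'n ^ 'n)"
  shows "Q ** (transpose Q ** B) = B" "transpose Q ** (Q ** B) = B"
    "Q ** transpose Q = mat 1" "transpose Q ** Q = mat 1"
    "Q *v (transpose Q *v x) = x" "transpose Q *v (Q *v x) = x"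
  using assms by (simp_all add: orthogonal_matrix_def matrix_mul_assoc matrix_vector_mul_assoc)

lemma symmetric_matrix_diagonalization:
  fixes A :: "real ^ 'n ^ 'n"
  assumes A: "transpose A = A"
  obtains Q d where "orthogonal_matrix Q" "A = transpose Q ** diag_mat d ** Q"
proof -
  obtain B where B: "card B = DIM(real ^ 'n)" "finite B" "pairwise orthogonal B"
      "\<forall>x\<in>B. norm x = 1" "\<forall>x\<in>B. \<exists>m. A *v x = m *\<^sub>R x"
    by (rule self_adjoint_eigenbasis[OF matrix_vector_mul_linear[of A] symmetric_inner_commute[OF A]]) (rule that)
  obtain q where q: "bij_betw q (UNIV :: 'n set) B"
    using B(1,2) finite_same_card_bij[of "UNIV :: 'n set" B] by auto
  have qB: "q i \<in> B" for i using q by (auto simp: bij_betw_def)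
  define Q where "Q = (\<chi> i. q i)"
  have "\<forall>i. \<exists>m. A *v q i = m *\<^sub>R q i" using B(5) qB by blast
  from choice[OF this] obtain d where d: "\<And>i. A *v q i = d i *\<^sub>R q i" by blast
  have orth: "q i \<bullet> q j = (if i = j then 1 else 0)" for i j
  proof (cases "i = j")
    case True then show ?thesis using B(4) qB[of j] by (simp add: norm_eq_1)
  next
    case False
    then have "q i \<noteq> q j" using q by (auto simp: bij_betw_def inj_def)
    then show ?thesis using B(3) qB False by (auto simp: pairwise_def orthogonal_def)
  qed
  have QQ: "Q ** transpose Q = mat 1"
    by (simp add: vec_eq_iff matrix_matrix_mult_def transpose_def Q_def mat_def
        orth[unfolded inner_vec_def, simplified])
  then have oQ: "orthogonal_matrix Q"
    by (simp add: orthogonal_matrix_def matrix_left_right_inverse)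
  have AQ: "A ** transpose Q = transpose Q ** diag_mat d"
  proof -
    have "(A ** transpose Q) $ i $ j = (transpose Q ** diag_mat d) $ i $ j" for i j
    proof -
      have "(A ** transpose Q) $ i $ j = (A *v q j) $ i"
        by (simp add: matrix_matrix_mult_def matrix_vector_mult_def transpose_def Q_def)
      also have "\<dots> = (transpose Q ** diag_mat d) $ i $ j"
        by (simp add: d matrix_matrix_mult_def diag_mat_def transpose_def Q_def
            if_distrib[of "\<lambda>c. _ * c"] cong: if_cong)
      finally show ?thesis .
    qed
    then show ?thesis by (simp add: vec_eq_iff)
  qed
  have "A = (A ** transpose Q) ** Q"
    using oQ by (simp add: matrix_mul_assoc[symmetric] orthogonal_matrix_def)
  then show ?thesis using that oQ AQ by simp
qed

lemma orthogonal_conjugate_mult: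
  assumes "orthogonal_matrix (Q :: real ^ 'n ^ 'n)"
  shows "(transpose Q ** diag_mat c ** Q) ** (transpose Q ** diag_mat d ** Q)
    = transpose Q ** diag_mat (\<lambda>i. c i * d i) ** Q"
proof -
  have "(transpose Q ** diag_mat c ** Q) ** (transpose Q ** diag_mat d ** Q)
    = transpose Q ** (diag_mat c ** (Q ** (transpose Q ** (diag_mat d ** Q))))"
    by (simp add: matrix_mul_assoc)
  also have "Q ** (transpose Q ** (diag_mat d ** Q)) = diag_mat d ** Q"
    by (rule orthogonal_matrix_cancel(1)[OF assms])
  also have "transpose Q ** (diag_mat c ** (diag_mat d ** Q)) = transpose Q ** (diag_mat c ** diag_mat d) ** Q"
    by (simp add: matrix_mul_assoc)
  finally show ?thesis by (simp add: diag_mat_mult)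
qed

lemma transpose_orthogonal_conjugate:
  "transpose (transpose Q ** diag_mat c ** Q) = transpose Q ** diag_mat c ** Q"
  by (simp add: matrix_transpose_mul transpose_diag_mat matrix_mul_assoc)

lemma quadratic_form_conjugate:
  "x \<bullet> ((transpose Q ** diag_mat c ** Q) *v x) = (\<Sum>i\<in>UNIV. c i * ((Q *v x) $ i)\<^sup>2)"
proof -
  have "x \<bullet> ((transpose Q ** diag_mat c ** Q) *v x) = (Q *v x) \<bullet> (diag_mat c *v (Q *v x))"
    by (simp add: matrix_vector_mul_assoc[symmetric] inner_matrix_vector_transpose)
  also have "\<dots> = (\<Sum>i\<in>UNIV. c i * ((Q *v x) $ i)\<^sup>2)"
    by (simp add: diag_mat_vec inner_vec_def power2_eq_square mult_ac)
  finally show ?thesis .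
qed

lemma trace_orthogonal_conjugate:
  assumes "orthogonal_matrix (Q :: real ^ 'n ^ 'n)"
  shows "trace (transpose Q ** diag_mat c ** Q) = (\<Sum>i\<in>UNIV. c i)"
  using trace_mul_sym[of "transpose Q ** diag_mat c" Q]
  by (simp add: orthogonal_matrix_cancel(1)[OF assms] trace_diag_mat)

lemma frobenius_norm_sq_trace: "(frobenius_norm (M :: real ^ 'n ^ 'm))\<^sup>2 = trace (transpose M ** M)"
  unfolding frobenius_norm_eq
  by (subst real_sqrt_pow2)
    (auto intro!: sum_nonneg sum.swap simp: trace_def matrix_matrix_mult_def transpose_def power2_eq_square)

text \<open>Test the operator norm on the \<open>i\<close>-th eigenvector, which has norm one.\<close>

lemma abs_eigenvalue_le_spectral_norm:
  assumes Q: "orthogonal_matrix (Q :: real ^ 'n ^ 'n)"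
  shows "\<bar>c i\<bar> \<le> spectral_norm (transpose Q ** diag_mat c ** Q)"
proof -
  let ?A = "transpose Q ** diag_mat c ** Q" and ?x = "transpose Q *v axis i 1"
  have nt: "norm (transpose Q *v y) = norm y" for y
  proof -
    have "(norm (transpose Q *v y))\<^sup>2 = (norm y)\<^sup>2"
      using inner_matrix_vector_transpose[of "transpose Q *v y" Q y]
      by (simp add: power2_norm_eq_inner orthogonal_matrix_cancel[OF Q])
    then show ?thesis by simp
  qed
  have "?A *v ?x = transpose Q *v (diag_mat c *v axis i 1)"
    by (simp add: matrix_vector_mul_assoc[symmetric] orthogonal_matrix_cancel[OF Q])
  also have "diag_mat c *v axis i 1 = c i *\<^sub>R axis i 1"
    by (simp add: diag_mat_vec axis_def vec_eq_iff)
  finally have "norm (?A *v ?x) = \<bar>c i\<bar>" by (simp add: nt matrix_vector_mult_scaleR)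
  moreover have "norm (?A *v ?x) \<le> onorm (\<lambda>x. ?A *v x) * norm ?x"
    by (rule onorm) (rule matrix_vector_mul_bounded_linear)
  ultimately show ?thesis by (simp add: spectral_norm_def nt)
qed

lemma pos_semidef_conjugate:
  assumes "\<And>i. 0 \<le> c i"
  shows "pos_semidef (transpose Q ** diag_mat c ** Q)"
  unfolding pos_semidef_def quadratic_form_conjugate
  using assms by (auto simp: transpose_orthogonal_conjugate intro!: sum_nonneg)

lemma pos_semidef_diagonalization:
  fixes A :: "real ^ 'n ^ 'n"
  assumes A: "pos_semidef A"
  obtains Q d where "orthogonal_matrix Q" "\<And>i. 0 \<le> d i" "A = transpose Q ** diag_mat d ** Q"
proof -
  obtain Q d where Q: "orthogonal_matrix Q" and d: "A = transpose Q ** diag_mat d ** Q"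
    using symmetric_matrix_diagonalization A unfolding pos_semidef_def by blast
  have "0 \<le> d i" for i
  proof -
    have "0 \<le> (transpose Q *v axis i 1) \<bullet> (A *v (transpose Q *v axis i 1))"
      using A by (simp add: pos_semidef_def)
    also have "\<dots> = (\<Sum>j\<in>UNIV. d j * (axis i 1 $ j)\<^sup>2)"
      by (simp add: d quadratic_form_conjugate orthogonal_matrix_cancel[OF Q])
    also have "\<dots> = d i"
      by (simp add: axis_def if_distrib[of "\<lambda>c. _ * c"] if_distrib[of "\<lambda>c. c ^ 2"] cong: if_cong)
    finally show ?thesis .
  qed
  then show ?thesis using that Q d by blast
qed

text \<open>Factor \<open>T^2 - s^2 = (T + s) (T - s)\<close>: the vector \<open>y = T x - s x\<close> satisfies \<open>T y = - s y\<close>, which for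
  positive \<open>s\<close> and semi-definite \<open>T\<close> is possible only if \<open>y = 0\<close>. For \<open>s = 0\<close> the factors coincide, and
  \<open>\<parallel>T x\<parallel>^2 = x \<bullet> T (T x)\<close> is used instead.\<close>

lemma psd_square_root_eigenvector:
  fixes T :: "real ^ 'n ^ 'n"
  assumes T: "pos_semidef T" and s: "0 \<le> s" and sq: "T *v (T *v x) = s\<^sup>2 *\<^sub>R x"
  shows "T *v x = s *\<^sub>R x"
proof (cases "s = 0")
  case True
  have "(T *v x) \<bullet> (T *v x) = x \<bullet> (T *v (T *v x))"
    using T by (simp add: pos_semidef_def symmetric_inner_commute)
  then show ?thesis using sq True by simp
next
  case False
  define y where "y = T *v x - s *\<^sub>R x"
  have Ty: "T *v y = - s *\<^sub>R y"
    by (simp add: y_def matrix_vector_mult_diff_distrib matrix_vector_mult_scaleR sq power2_eq_square algebra_simps)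
  have "0 \<le> y \<bullet> (T *v y)" using T by (simp add: pos_semidef_def)
  then have "s * (y \<bullet> y) \<le> 0" by (simp add: Ty)
  then have "y = 0" using s False
    by (metis inner_eq_zero_iff inner_ge_zero mult_le_0_iff order_antisym)
  then show ?thesis by (simp add: y_def)
qed

text \<open>Each eigenvector of \<open>S\<close> is an eigenvector of \<open>S ** S = T ** T\<close>, hence of \<open>T\<close> with the same
  eigenvalue; so \<open>S\<close> and \<open>T\<close> agree on an eigenbasis of \<open>S\<close>.\<close>

lemma psd_square_root_unique:
  fixes S T :: "real ^ 'n ^ 'n"
  assumes S: "pos_semidef S" and T: "pos_semidef T" and eq: "S ** S = T ** T"
  shows "S = T"
proof -
  obtain Q s where Q: "orthogonal_matrix Q" and s: "\<And>i. 0 \<le> s i" and S': "S = transpose Q ** diag_mat s ** Q"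
    using pos_semidef_diagonalization[OF S] by blast
  have ax: "T *v (transpose Q *v axis i 1) = S *v (transpose Q *v axis i 1)" for i
  proof -
    have *: "(transpose Q ** diag_mat c ** Q) *v (transpose Q *v axis i 1) = c i *\<^sub>R (transpose Q *v axis i 1)" for c
    proof -
      have "(transpose Q ** diag_mat c ** Q) *v (transpose Q *v axis i 1) = transpose Q *v (diag_mat c *v axis i 1)"
        by (simp add: matrix_vector_mul_assoc[symmetric] orthogonal_matrix_cancel[OF Q])
      also have "diag_mat c *v axis i 1 = c i *\<^sub>R axis i 1"
        by (simp add: diag_mat_vec axis_def vec_eq_iff)
      finally show ?thesis by (simp add: matrix_vector_mult_scaleR)
    qed
    have "T *v (T *v (transpose Q *v axis i 1)) = (s i)\<^sup>2 *\<^sub>R (transpose Q *v axis i 1)"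
    proof -
      have "T *v (T *v y) = (S ** S) *v y" for y by (simp add: eq matrix_vector_mul_assoc)
      then show ?thesis
        using *[of "\<lambda>i. s i * s i"] orthogonal_conjugate_mult[OF Q, of s s]
        by (simp add: S' power2_eq_square)
    qed
    from psd_square_root_eigenvector[OF T s this] show ?thesis using * S' by simp
  qed
  have "T ** transpose Q = S ** transpose Q"
  proof -
    have "column i (T ** transpose Q) = column i (S ** transpose Q)" for i
      using ax[of i] by (simp only: matrix_vector_mul_assoc matrix_vector_mult_basis[symmetric])
    then show ?thesis by (simp add: column_def vec_eq_iff)
  qed
  then have "T ** transpose Q ** Q = S ** transpose Q ** Q" by simp
  then show ?thesis by (simp add: matrix_mul_assoc[symmetric] orthogonal_matrix_cancel[OF Q])
qed

lemma mat_sqrt: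
  fixes A :: "real ^ 'n ^ 'n"
  assumes A: "pos_semidef A"
  shows pos_semidef_mat_sqrt: "pos_semidef (mat_sqrt A)" and mat_sqrt_mult: "mat_sqrt A ** mat_sqrt A = A"
proof -
  obtain Q d where Q: "orthogonal_matrix Q" and d: "\<And>i. 0 \<le> d i" and A': "A = transpose Q ** diag_mat d ** Q"
    using pos_semidef_diagonalization[OF A] by blast
  let ?S = "transpose Q ** diag_mat (\<lambda>i. sqrt (d i)) ** Q"
  have "pos_semidef ?S \<and> ?S ** ?S = A"
    using d by (simp add: pos_semidef_conjugate orthogonal_conjugate_mult[OF Q] A')
  then have "\<exists>!S. pos_semidef S \<and> S ** S = A" by (auto intro: psd_square_root_unique)
  from theI'[OF this] show "pos_semidef (mat_sqrt A)" "mat_sqrt A ** mat_sqrt A = A"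
    by (simp_all add: mat_sqrt_def)
qed

lemma mat_inv_sqrt:
  fixes A :: "real ^ 'n ^ 'n"
  assumes A: "pos_semidef A" and inv: "invertible A"
  shows transpose_mat_inv_sqrt: "transpose (mat_inv_sqrt A) = mat_inv_sqrt A"
    and invertible_mat_inv_sqrt: "invertible (mat_inv_sqrt A)"
    and mat_inv_sqrt_conjugate: "mat_inv_sqrt A ** A ** mat_inv_sqrt A = mat 1"
    and mat_inv_sqrt_mult: "mat_inv_sqrt A ** mat_inv_sqrt A = matrix_inv A"
proof -
  let ?S = "mat_sqrt A" and ?W = "mat_inv_sqrt A"
  have SS: "?S ** ?S = A" and St: "transpose ?S = ?S"
    using mat_sqrt[OF A] by (auto simp: pos_semidef_def)
  have "det ?S * det ?S = det A" by (simp add: SS det_mul[symmetric])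
  then have iS: "invertible ?S" using inv by (auto simp: invertible_det_nz)
  have 1: "?S ** ?W = mat 1" "?W ** ?S = mat 1"
    using matrix_inv_cancel[OF iS] by (simp_all add: mat_inv_sqrt_def)
  have uniq: "X = ?W" if "X ** ?S = mat 1" for X
    by (metis 1(1) matrix_mul_assoc matrix_mul_lid matrix_mul_rid that)
  show "transpose ?W = ?W"
    by (rule uniq) (metis 1(1) St matrix_transpose_mul transpose_mat)
  show "invertible ?W" using 1 by (auto simp: invertible_def)
  have "?W ** (?S ** ?S) ** ?W = (?W ** ?S) ** (?S ** ?W)" by (simp only: matrix_mul_assoc)
  then show "?W ** A ** ?W = mat 1" by (simp add: 1 SS)
  have "(?W ** ?W) ** (?S ** ?S) = ?W ** (?W ** ?S) ** ?S" by (simp only: matrix_mul_assoc)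
  then have 2: "(?W ** ?W) ** A = mat 1" by (simp add: 1 SS)
  then show "?W ** ?W = matrix_inv A"
    by (metis inv matrix_inv_cancel(1) matrix_mul_assoc matrix_mul_lid matrix_mul_rid)
qed

section \<open>Linear images of Gaussian vectors\<close>

lemma nn_integral_lborel_translate:
  fixes f :: "'a::euclidean_space \<Rightarrow> ennreal"
  assumes [measurable]: "f \<in> borel_measurable borel"
  shows "(\<integral>\<^sup>+x. f (t + x) \<partial>lborel) = (\<integral>\<^sup>+x. f x \<partial>lborel)"
proof -
  have "(\<integral>\<^sup>+x. f x \<partial>lborel) = (\<integral>\<^sup>+x. f x \<partial>distr lborel borel ((+) t))"
    by (simp only: lborel_distr_plus)
  also have "\<dots> = (\<integral>\<^sup>+x. f (t + x) \<partial>lborel)" by (subst nn_integral_distr) auto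
  finally show ?thesis by simp
qed

lemma nn_integral_lborel_reflect:
  fixes f :: "'a::euclidean_space \<Rightarrow> ennreal"
  assumes [measurable]: "f \<in> borel_measurable borel"
  shows "(\<integral>\<^sup>+x. f (t - x) \<partial>lborel) = (\<integral>\<^sup>+x. f x \<partial>lborel)"
proof -
  have "lborel = distr lborel borel (\<lambda>x::'a. t + (-1) *\<^sub>R x)"
    using lborel_affine[of "-1" t] by (simp add: density_1)
  then have "(\<integral>\<^sup>+x. f x \<partial>lborel) = (\<integral>\<^sup>+x. f x \<partial>distr lborel borel (\<lambda>x::'a. t + (-1) *\<^sub>R x))"
    by simp
  also have "\<dots> = (\<integral>\<^sup>+x. f (t - x) \<partial>lborel)" by (subst nn_integral_distr) auto
  finally show ?thesis by simp
qed

text \<open>The image of Lebesgue measure under a linear bijection is translation invariant, hence a multiple of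
  Lebesgue measure. The proportionality comes from integrating \<open>B(y) f(T x - y)\<close> over \<open>x\<close> and \<open>y\<close> in both
  orders, where \<open>B\<close> is the indicator of the unit cube: one order yields the left-hand side, the other
  \<open>c\<close> times the integral of \<open>f\<close>. The value \<open>\<bar>det T\<bar>^(-1)\<close> of the constant never enters.\<close>

lemma nn_integral_lborel_linear:
  fixes T :: "'a::euclidean_space \<Rightarrow> 'a"
  assumes lin: "linear T" and surj: "surj T"
  obtains c where "\<And>f. f \<in> borel_measurable borel \<Longrightarrow>
    (\<integral>\<^sup>+x. f (T x) \<partial>lborel) = c * (\<integral>\<^sup>+x. f x \<partial>lborel)"
proof -
  have [measurable]: "T \<in> borel_measurable borel"
    using lin by (intro borel_measurable_continuous_onI linear_continuous_on)
      (simp add: linear_conv_bounded_linear)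
  let ?B = "indicator (cbox 0 One) :: 'a \<Rightarrow> ennreal"
  have B1: "(\<integral>\<^sup>+y. ?B y \<partial>lborel) = 1" by (simp add: emeasure_lborel_cbox_eq)
  define c where "c = (\<integral>\<^sup>+x. ?B (T x) \<partial>lborel)"
  have "(\<integral>\<^sup>+x. f (T x) \<partial>lborel) = c * (\<integral>\<^sup>+x. f x \<partial>lborel)" if [measurable]: "f \<in> borel_measurable borel"
    for f :: "'a \<Rightarrow> ennreal"
  proof -
    have shift: "(\<integral>\<^sup>+x. g (T x - y) \<partial>lborel) = (\<integral>\<^sup>+x. g (T x) \<partial>lborel)"
      if [measurable]: "g \<in> borel_measurable borel" for g :: "'a \<Rightarrow> ennreal" and y
    proof -
      obtain z where "T z = - y" using surj by (metis surjD)
      then have "g (T x - y) = g (T (z + x))" for x by (simp add: linear_add[OF lin])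
      then show ?thesis using nn_integral_lborel_translate[of "\<lambda>x. g (T x)" z] by simp
    qed
    have "(\<integral>\<^sup>+x. f (T x) \<partial>lborel) = (\<integral>\<^sup>+y. ?B y * (\<integral>\<^sup>+x. f (T x) \<partial>lborel) \<partial>lborel)"
      by (subst nn_integral_multc) (simp_all add: B1)
    also have "\<dots> = (\<integral>\<^sup>+y. (\<integral>\<^sup>+x. ?B y * f (T x - y) \<partial>lborel) \<partial>lborel)"
      by (intro nn_integral_cong) (simp add: nn_integral_cmult shift)
    also have "\<dots> = (\<integral>\<^sup>+x. (\<integral>\<^sup>+y. ?B y * f (T x - y) \<partial>lborel) \<partial>lborel)"
      by (rule lborel_pair.Fubini') simp
    also have "\<dots> = (\<integral>\<^sup>+x. (\<integral>\<^sup>+y. ?B (T x - y) * f y \<partial>lborel) \<partial>lborel)"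
    proof (rule nn_integral_cong)
      fix x
      show "(\<integral>\<^sup>+y. ?B y * f (T x - y) \<partial>lborel) = (\<integral>\<^sup>+y. ?B (T x - y) * f y \<partial>lborel)"
        using nn_integral_lborel_reflect[of "\<lambda>y. ?B (T x - y) * f y" "T x"] by simp
    qed
    also have "\<dots> = (\<integral>\<^sup>+y. (\<integral>\<^sup>+x. ?B (T x - y) * f y \<partial>lborel) \<partial>lborel)"
      by (rule lborel_pair.Fubini') simp
    also have "\<dots> = (\<integral>\<^sup>+y. c * f y \<partial>lborel)"
      by (intro nn_integral_cong) (simp add: nn_integral_multc shift c_def)
    also have "\<dots> = c * (\<integral>\<^sup>+y. f y \<partial>lborel)" by (rule nn_integral_cmult) simp
    finally show ?thesis .
  qed
  then show ?thesis using that by blast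
qed

definition std_gaussian :: "'a::euclidean_space measure" where
  "std_gaussian = density lborel (\<lambda>x. ennreal (\<Prod>b\<in>Basis. std_normal_density (x \<bullet> b)))"

lemma prod_std_normal_density:
  "(\<Prod>b\<in>Basis. std_normal_density ((x :: 'a::euclidean_space) \<bullet> b))
    = (1 / sqrt (2 * pi)) ^ DIM('a) * exp (- (norm x)\<^sup>2 / 2)"
proof -
  have "(norm x)\<^sup>2 = (\<Sum>b\<in>Basis. (x \<bullet> b)\<^sup>2)"
    by (simp add: norm_eq_sqrt_inner euclidean_inner[of x x] power2_eq_square sum_nonneg)
  then have "(\<Prod>b\<in>Basis. exp (- (x \<bullet> b)\<^sup>2 / 2)) = exp (- (norm x)\<^sup>2 / 2)"
    by (simp add: exp_sum[symmetric] sum_negf sum_divide_distrib)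
  then show ?thesis by (simp add: std_normal_density_def prod.distrib prod_dividef power_one_over)
qed

lemma nn_integral_prod_std_normal_density:
  "(\<integral>\<^sup>+x. ennreal (\<Prod>b\<in>Basis. std_normal_density ((x :: 'a::euclidean_space) \<bullet> b)) \<partial>lborel) = 1"
proof -
  interpret N: prob_space std_normal_distribution by (rule prob_space_normal_density) simp
  have "(\<integral>\<^sup>+x. ennreal (std_normal_density x) \<partial>lborel) = 1"
    using N.emeasure_space_1 by (simp add: emeasure_density)
  then show ?thesis
    using nn_integral_lborel_prod[of "\<lambda>_ x. ennreal (std_normal_density x)"] by (simp add: prod_ennreal)
qed

text \<open>Transporting the density along \<open>L\<close> produces an unknown multiple of the standard Gaussian density. Both
  sides are probability measures, so the multiple is one, whatever the normalization \<open>k\<close>.\<close>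

lemma distr_linear_std_gaussian:
  fixes L :: "'a::euclidean_space \<Rightarrow> 'a"
  assumes M: "prob_space M" and dist: "distributed M lborel Y (\<lambda>y. ennreal (k * exp (- (norm (L y))\<^sup>2 / 2)))"
    and lin: "linear L" and surj: "surj L"
  shows "distr M borel (\<lambda>\<omega>. L (Y \<omega>)) = std_gaussian" (is "?D = _")
proof -
  interpret M: prob_space M by fact
  have [measurable]: "L \<in> borel_measurable borel"
    using lin by (intro borel_measurable_continuous_onI linear_continuous_on)
      (simp add: linear_conv_bounded_linear)
  have [measurable]: "Y \<in> borel_measurable M" using distributed_measurable[OF dist] by simp
  obtain c where c: "\<And>f. f \<in> borel_measurable borel \<Longrightarrow>
    (\<integral>\<^sup>+x. f (L x) \<partial>lborel) = c * (\<integral>\<^sup>+x. f x \<partial>lborel)"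
    using nn_integral_lborel_linear[OF lin surj] by blast
  let ?p = "\<lambda>x::'a. ennreal (\<Prod>b\<in>Basis. std_normal_density (x \<bullet> b))"
  define K where "K = (1 / sqrt (2 * pi)) ^ DIM('a)"
  have K: "0 < K" by (simp add: K_def)
  have expK: "ennreal (k * exp (- (norm x)\<^sup>2 / 2)) = ennreal (k / K) * ?p x" for x :: 'a
    unfolding prod_std_normal_density K_def[symmetric] using K
    by (simp add: ennreal_mult''[symmetric])
  have E: "emeasure (distr M borel (\<lambda>\<omega>. L (Y \<omega>))) A = c * ennreal (k / K) * (\<integral>\<^sup>+x. ?p x * indicator A x \<partial>lborel)"
    if [measurable]: "A \<in> sets borel" for A
  proof -
    have [measurable]: "L -` A \<in> sets borel" using measurable_sets_borel[of L borel A] by simp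
    have "emeasure (distr M borel (\<lambda>\<omega>. L (Y \<omega>))) A = emeasure (distr M lborel Y) (L -` A)"
      by (simp add: emeasure_distr vimage_def)
    also have "\<dots> = (\<integral>\<^sup>+y. ennreal (k * exp (- (norm (L y))\<^sup>2 / 2)) * indicator (L -` A) y \<partial>lborel)"
      by (simp add: distributed_distr_eq_density[OF dist] emeasure_density)
    also have "\<dots> = (\<integral>\<^sup>+y. ennreal (k / K) * (?p (L y) * indicator A (L y)) \<partial>lborel)"
      by (intro nn_integral_cong, subst expK) (simp add: mult.assoc indicator_def)
    also have "\<dots> = c * (\<integral>\<^sup>+x. ennreal (k / K) * (?p x * indicator A x) \<partial>lborel)"
      by (subst c[symmetric]) simp_all
    finally show ?thesis by (simp add: nn_integral_cmult mult.assoc)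
  qed
  interpret D: prob_space "distr M borel (\<lambda>\<omega>. L (Y \<omega>))" by (rule M.prob_space_distr) simp
  have "c * ennreal (k / K) = 1"
    using E[of UNIV] D.emeasure_space_1 by (simp add: nn_integral_prod_std_normal_density)
  then show ?thesis unfolding std_gaussian_def
    by (intro measure_eqI) (simp_all add: E emeasure_density)
qed

lemma integral_std_gaussian_prod:
  fixes F :: "'a::euclidean_space \<Rightarrow> real \<Rightarrow> complex"
  assumes F: "\<And>b. b \<in> Basis \<Longrightarrow> integrable std_normal_distribution (F b)"
  shows "(\<integral>x. (\<Prod>b\<in>Basis. F b (x \<bullet> b)) \<partial>std_gaussian) = (\<Prod>b\<in>Basis. \<integral>x. F b x \<partial>std_normal_distribution)"
proof -
  interpret product_sigma_finite "\<lambda>_::'a. lborel :: real measure" ..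
  have [measurable]: "F b \<in> borel_measurable borel" if "b \<in> Basis" for b
    using borel_measurable_integrable[OF F[OF that]] by simp
  have int: "integrable lborel (\<lambda>x. std_normal_density x *\<^sub>R F b x)" if "b \<in> Basis" for b
    using F[OF that] that by (simp add: integrable_density)
  have "(\<integral>x. (\<Prod>b\<in>Basis. F b (x \<bullet> b)) \<partial>std_gaussian)
    = (\<integral>x. (\<Prod>b\<in>Basis. std_normal_density (x \<bullet> b) *\<^sub>R F b (x \<bullet> b)) \<partial>lborel)"
    unfolding std_gaussian_def
    by (subst integral_density) (auto simp: prod_nonneg scaleR_conv_of_real prod.distrib)
  also have "\<dots> = (\<integral>f. (\<Prod>b\<in>Basis. std_normal_density (f b) *\<^sub>R F b (f b)) \<partial>(\<Pi>\<^sub>M b\<in>Basis. lborel))"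
    by (subst lborel_eq, subst integral_distr) (auto intro!: Bochner_Integration.integral_cong prod.cong simp: inner_sum_left inner_Basis if_distrib cong: if_cong)
  also have "\<dots> = (\<Prod>b\<in>Basis. \<integral>x. std_normal_density x *\<^sub>R F b x \<partial>lborel)"
    by (rule product_integral_prod) (auto intro: int)
  also have "\<dots> = (\<Prod>b\<in>Basis. \<integral>x. F b x \<partial>std_normal_distribution)"
    by (intro prod.cong) (simp_all add: integral_density)
  finally show ?thesis .
qed

lemma prod_Basis_vec:
  fixes h :: "real ^ 'n \<Rightarrow> 'c::comm_monoid_mult"
  shows "(\<Prod>b\<in>Basis. h b) = (\<Prod>i\<in>UNIV. h (axis i 1))"
proof -
  have B: "Basis = range (\<lambda>i::'n. axis i (1::real))" by (auto simp: Basis_vec_def)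
  have "inj (\<lambda>i::'n. axis i (1::real))" by (simp add: inj_def axis_eq_axis)
  then show ?thesis unfolding B by (subst prod.reindex) simp_all
qed

lemma integral_std_gaussian_prod_vec:
  fixes F :: "'n::finite \<Rightarrow> real \<Rightarrow> complex"
  assumes F: "\<And>i. integrable std_normal_distribution (F i)"
  shows "(\<integral>x. (\<Prod>i\<in>UNIV. F i (x $ i)) \<partial>(std_gaussian :: (real ^ 'n) measure))
    = (\<Prod>i\<in>UNIV. \<integral>x. F i x \<partial>std_normal_distribution)"
  using integral_std_gaussian_prod[of "\<lambda>b :: real ^ 'n. F (axis_index b)"] F
  by (simp add: prod_Basis_vec inner_axis)

section \<open>The characteristic function of a centred half square\<close>

text \<open>Concavity of the logarithm between the points \<open>1\<close> and \<open>1 + x\<close>.\<close>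

lemma ln_one_plus_scaled_ge:
  fixes x \<theta> :: real
  assumes "0 \<le> x" "0 \<le> \<theta>" "\<theta> \<le> 1"
  shows "\<theta> * ln (1 + x) \<le> ln (1 + \<theta> * x)"
proof -
  have "concave_on {0<..} (ln :: real \<Rightarrow> real)" by (rule ln_concave)
  from concave_onD[OF this, of \<theta> 1 "1 + x"] assms
  show ?thesis by (simp add: algebra_simps)
qed

text \<open>Integrate the derivative of \<open>exp\<close> along the segment from \<open>w\<close> to \<open>u\<close>. By convexity its modulus
  \<open>exp (Re z)\<close> lies below the chord between the end points, whose mean value is the average of the two
  ends. Averaging the ends, rather than taking the larger one, halves the weight of the end that decays
  more slowly, and the final constants depend on this.\<close>

lemma norm_exp_diff_le:
  fixes u w :: complex
  shows "norm (exp u - exp w) \<le> norm (u - w) * (exp (Re u) + exp (Re w)) / 2"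
proof -
  let ?f = "\<lambda>\<tau>::real. exp (w + of_real \<tau> * (u - w))"
  let ?\<phi> = "\<lambda>\<tau>::real. norm (u - w) * ((\<tau> - \<tau>\<^sup>2 / 2) * exp (Re w) + \<tau>\<^sup>2 / 2 * exp (Re u))"
  have "norm (?f 1 - ?f 0) \<le> ?\<phi> 1 - ?\<phi> 0"
  proof (rule differentiable_bound_general[where f' = "\<lambda>\<tau>. (u - w) * ?f \<tau>"
        and \<phi>' = "\<lambda>\<tau>. norm (u - w) * ((1 - \<tau>) * exp (Re w) + \<tau> * exp (Re u))"])
    show "(?f has_vector_derivative (u - w) * ?f \<tau>) (at \<tau>)" for \<tau>
    proof -
      have "((\<lambda>z. exp (w + z * (u - w))) has_field_derivative (u - w) * exp (w + of_real \<tau> * (u - w))) (at (of_real \<tau>))"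
        by (auto intro!: derivative_eq_intros)
      then show ?thesis by (rule has_vector_derivative_real_field)
    qed
    show "(?\<phi> has_vector_derivative norm (u - w) * ((1 - \<tau>) * exp (Re w) + \<tau> * exp (Re u))) (at \<tau>)" for \<tau>
      unfolding has_real_derivative_iff_has_vector_derivative[symmetric]
      by (auto intro!: derivative_eq_intros simp: algebra_simps)
    show "norm ((u - w) * ?f \<tau>) \<le> norm (u - w) * ((1 - \<tau>) * exp (Re w) + \<tau> * exp (Re u))"
      if "0 < \<tau>" "\<tau> < 1" for \<tau>
    proof -
      have "exp ((1 - \<tau>) * Re w + \<tau> * Re u) \<le> (1 - \<tau>) * exp (Re w) + \<tau> * exp (Re u)"
        using convex_onD[OF exp_convex, of \<tau> "Re w" "Re u"] that by simp
      moreover have "(1 - \<tau>) * Re w + \<tau> * Re u = Re (w + of_real \<tau> * (u - w))"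
        by (simp add: algebra_simps)
      ultimately show ?thesis unfolding norm_mult norm_exp_eq_Re by (simp add: mult_left_mono)
    qed
  qed (auto intro!: continuous_intros)
  then show ?thesis by (simp add: algebra_simps)
qed

text \<open>The logarithm of the characteristic function of \<open>(X^2 - 1) / 2\<close> for a standard normal \<open>X\<close>; see
  \<open>expectation_iexp_half_square\<close>.\<close>

definition log_char_half_square :: "real \<Rightarrow> complex" where
  "log_char_half_square x = - \<i> * x / 2 - Ln (1 - \<i> * x) / 2"

lemma one_minus_i_times_real: "1 - \<i> * of_real x \<notin> \<real>\<^sub>\<le>\<^sub>0" "1 - \<i> * of_real x \<noteq> 0"
  "norm (1 - \<i> * of_real x) = sqrt (1 + x\<^sup>2)"
  by (auto simp: complex_nonpos_Reals_iff complex_eq_iff cmod_def)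

lemma log_char_half_square_derivative:
  "(log_char_half_square has_vector_derivative - of_real x / (2 * (1 - \<i> * x))) (at x within S)"
proof -
  have "((\<lambda>z. 1 - \<i> * z) has_field_derivative - \<i>) (at (of_real x))"
    by (auto intro!: derivative_eq_intros)
  from DERIV_chain2[OF has_field_derivative_Ln[OF one_minus_i_times_real(1)] this]
  have "((\<lambda>z. Ln (1 - \<i> * z)) has_field_derivative inverse (1 - \<i> * x) * (- \<i>)) (at (of_real x))" .
  then have "((\<lambda>z. - \<i> * z / 2 - Ln (1 - \<i> * z) / 2) has_field_derivative
      (- \<i> * 1) / 2 - (inverse (1 - \<i> * x) * (- \<i>)) / 2) (at (of_real x))"
    by (intro DERIV_diff DERIV_cdivide DERIV_cmult DERIV_ident)
  also have "(- \<i> * 1) / 2 - (inverse (1 - \<i> * x) * (- \<i>)) / 2 = - of_real x / (2 * (1 - \<i> * x))"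
  proof -
    have "(- \<i> * 1) / 2 - (inverse w * (- \<i>)) / 2 = - y / (2 * w)"
      if "w \<noteq> 0" "w = 1 - \<i> * y" for w y :: complex
    proof -
      have "(- \<i> * 1) / 2 - (inverse w * (- \<i>)) / 2 = (- \<i> * w + \<i>) / (2 * w)"
        using that(1) by (simp add: field_simps)
      also have "- \<i> * w + \<i> = - y" by (simp add: that(2) algebra_simps)
      finally show ?thesis .
    qed
    then show ?thesis using one_minus_i_times_real(2) by blast
  qed
  finally show ?thesis
    unfolding log_char_half_square_def[abs_def] by (rule has_vector_derivative_real_field)
qed

text \<open>The left-hand side vanishes at \<open>0\<close> and has derivative \<open>- i x^2 / (2 (1 - i x))\<close>, of modulus at most
  \<open>x^2 / 2\<close> because \<open>\<bar>1 - i x\<bar> \<ge> 1\<close>. Unlike a power series argument this has no radius of convergence.\<close>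

lemma log_char_half_square_approx_nonneg:
  assumes "0 \<le> x"
  shows "norm (log_char_half_square x + (of_real x)\<^sup>2 / 4) \<le> x ^ 3 / 6"
proof (cases "x = 0")
  case True then show ?thesis by (simp add: log_char_half_square_def)
next
  case False
  let ?f = "\<lambda>x. log_char_half_square x + (of_real x)\<^sup>2 / 4"
  have deriv: "(?f has_vector_derivative - \<i> * (of_real t)\<^sup>2 / (2 * (1 - \<i> * t))) (at t within S)" for t S
  proof -
    have "((\<lambda>x. (of_real x :: complex)\<^sup>2 / 4) has_vector_derivative of_real t / 2) (at t within S)"
      by (rule has_vector_derivative_real_field) (auto intro!: derivative_eq_intros)
    from has_vector_derivative_add[OF log_char_half_square_derivative this]
    have "(?f has_vector_derivative - of_real t / (2 * (1 - \<i> * t)) + of_real t / 2) (at t within S)" .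
    also have "- of_real t / (2 * (1 - \<i> * t)) + of_real t / 2 = - \<i> * (of_real t)\<^sup>2 / (2 * (1 - \<i> * t))"
      using one_minus_i_times_real(2)[of t] by (simp add: divide_simps) (simp add: algebra_simps power2_eq_square)
    finally show ?thesis .
  qed
  have "norm (?f x - ?f 0) \<le> x ^ 3 / 6 - 0 ^ 3 / 6"
  proof (rule differentiable_bound_general[where f' = "\<lambda>t. - \<i> * (of_real t)\<^sup>2 / (2 * (1 - \<i> * t))"
        and \<phi>' = "\<lambda>t. t\<^sup>2 / 2"])
    show "0 < x" using assms False by simp
    show "continuous_on {0..x} ?f"
      unfolding continuous_on_eq_continuous_within
      using deriv has_vector_derivative_continuous by blast
    show "continuous_on {0..x} (\<lambda>x. x ^ 3 / 6)" by (intro continuous_intros) simp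
    show "(?f has_vector_derivative - \<i> * (of_real t)\<^sup>2 / (2 * (1 - \<i> * t))) (at t)" for t by (rule deriv)
    show "((\<lambda>x. x ^ 3 / 6) has_vector_derivative t\<^sup>2 / 2) (at t)" for t :: real
      unfolding has_real_derivative_iff_has_vector_derivative[symmetric]
      by (auto intro!: derivative_eq_intros)
    show "norm (- \<i> * (of_real t)\<^sup>2 / (2 * (1 - \<i> * t))) \<le> t\<^sup>2 / 2" for t
    proof -
      have "norm (- \<i> * (of_real t)\<^sup>2 / (2 * (1 - \<i> * t))) = t\<^sup>2 / 2 / norm (1 - \<i> * of_real t)"
        unfolding norm_divide norm_mult norm_power by simp
      also have "\<dots> \<le> t\<^sup>2 / 2 / 1"
        by (intro divide_left_mono) (simp_all add: one_minus_i_times_real add_pos_nonneg)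
      finally show ?thesis by simp
    qed
  qed
  then show ?thesis by (simp add: log_char_half_square_def)
qed

lemma cnj_log_char_half_square: "cnj (log_char_half_square x) = log_char_half_square (- x)"
  using one_minus_i_times_real(1)[of x] by (simp add: log_char_half_square_def cnj_Ln)

lemma log_char_half_square_approx: "norm (log_char_half_square x + (of_real x)\<^sup>2 / 4) \<le> \<bar>x\<bar> ^ 3 / 6"
proof (cases "0 \<le> x")
  case True then show ?thesis using log_char_half_square_approx_nonneg[of x] by simp
next
  case False
  have "norm (log_char_half_square x + (of_real x)\<^sup>2 / 4) = norm (cnj (log_char_half_square x + (of_real x)\<^sup>2 / 4))" by (simp only: complex_mod_cnj)
  also have "\<dots> = norm (log_char_half_square (- x) + (of_real (- x))\<^sup>2 / 4)" by (simp add: cnj_log_char_half_square)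
  also have "\<dots> \<le> (- x) ^ 3 / 6" using False by (intro log_char_half_square_approx_nonneg) simp
  finally show ?thesis using False by simp
qed

lemma exp_Re_log_char_half_square: "exp (Re (log_char_half_square x)) = (1 + x\<^sup>2) powr (- 1 / 4)"
proof -
  have "Re (log_char_half_square x) = - ln (sqrt (1 + x\<^sup>2)) / 2"
    using one_minus_i_times_real[of x] by (simp add: log_char_half_square_def)
  then show ?thesis by (simp add: powr_def ln_sqrt add_pos_nonneg add_nonneg_eq_0_iff)
qed


text \<open>With a finite second moment, differentiation under the expectation follows from
  \<open>\<bar>exp (i y) - 1 - i y\<bar> \<le> y^2 / 2\<close> alone: the remainder of the difference quotient is of order
  \<open>\<bar>s - t\<bar>\<close>.\<close>

lemma (in prob_space) has_vector_derivative_expectation_iexp: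
  fixes f :: "'a \<Rightarrow> real"
  assumes int1: "integrable M f" and int2: "integrable M (\<lambda>x. (f x)\<^sup>2)"
  shows "((\<lambda>t. \<integral>x. iexp (t * f x) \<partial>M) has_vector_derivative (\<integral>x. \<i> * f x * iexp (t * f x) \<partial>M)) (at t)"
proof -
  have [measurable]: "f \<in> borel_measurable M" using int1 by auto
  let ?h = "\<lambda>t. \<integral>x. iexp (t * f x) \<partial>M" and ?D = "\<integral>x. \<i> * f x * iexp (t * f x) \<partial>M"
  let ?C = "\<integral>x. (f x)\<^sup>2 \<partial>M"
  have i0: "integrable M (\<lambda>x. iexp (s * f x))" for s
    by (rule integrable_const_bound[where B = 1]) auto
  have i1: "integrable M (\<lambda>x. \<i> * f x * iexp (t * f x))"
    by (rule Bochner_Integration.integrable_bound[OF int1]) (auto simp: norm_mult norm_power)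
  have bound: "norm (?h s - ?h t - (s - t) *\<^sub>R ?D) \<le> \<bar>s - t\<bar>\<^sup>2 / 2 * ?C" for s
  proof -
    have pt: "norm (iexp (s * f x) - iexp (t * f x) - of_real (s - t) * (\<i> * f x * iexp (t * f x)))
      \<le> \<bar>s - t\<bar>\<^sup>2 / 2 * (f x)\<^sup>2" for x
    proof -
      let ?y = "(s - t) * f x"
      have "iexp (s * f x) = iexp (t * f x) * iexp ?y"
        by (simp add: exp_add[symmetric] algebra_simps)
      then have "iexp (s * f x) - iexp (t * f x) - of_real (s - t) * (\<i> * f x * iexp (t * f x))
        = iexp (t * f x) * (iexp ?y - (\<Sum>k\<le>1. (\<i> * ?y) ^ k / fact k))"
        by (simp add: algebra_simps)
      also have "norm \<dots> \<le> \<bar>?y\<bar> ^ 2 / 2"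
        using iexp_approx1[of ?y 1] by (simp add: norm_mult fact_2 eval_nat_numeral)
      finally show ?thesis by (simp add: power_mult_distrib abs_mult)
    qed
    have "?h s - ?h t - (s - t) *\<^sub>R ?D
      = (\<integral>x. iexp (s * f x) - iexp (t * f x) - of_real (s - t) * (\<i> * f x * iexp (t * f x)) \<partial>M)"
      using i0 i1 by (simp add: scaleR_conv_of_real)
    also have "norm \<dots> \<le> (\<integral>x. \<bar>s - t\<bar>\<^sup>2 / 2 * (f x)\<^sup>2 \<partial>M)"
      by (rule order_trans[OF integral_norm_bound integral_mono])
        (intro integrable_norm Bochner_Integration.integrable_diff integrable_mult_right i0 i1 int2 pt)+
    finally show ?thesis by simp
  qed
  show ?thesis
    unfolding has_vector_derivative_def has_derivative_iff_norm
  proof (intro conjI bounded_linear_scaleR_left)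
    show "((\<lambda>s. norm (?h s - ?h t - (s - t) *\<^sub>R ?D) / norm (s - t)) \<longlongrightarrow> 0) (at t)"
    proof (rule Lim_null_comparison)
      show "\<forall>\<^sub>F s in at t. norm (norm (?h s - ?h t - (s - t) *\<^sub>R ?D) / norm (s - t)) \<le> \<bar>s - t\<bar> * (?C / 2)"
        unfolding eventually_at_filter
      proof (intro always_eventually allI impI)
        fix s assume "s \<noteq> t"
        then show "norm (norm (?h s - ?h t - (s - t) *\<^sub>R ?D) / norm (s - t)) \<le> \<bar>s - t\<bar> * (?C / 2)"
          using bound[of s] by (simp add: pos_divide_le_eq power2_eq_square mult_ac)
      qed
      show "((\<lambda>s. \<bar>s - t\<bar> * (?C / 2)) \<longlongrightarrow> 0) (at t)"
        by (auto intro!: tendsto_eq_intros)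
    qed
  qed
qed

text \<open>The difference of the two sides is the integral of the derivative of
  \<open>- x exp (- (1 - i \<theta>) x^2 / 2)\<close>, up to a constant factor, and this function vanishes at both ends.\<close>

lemma gaussian_complex_by_parts:
  fixes \<theta> :: real
  shows "(1 - \<i> * \<theta>) * (\<integral>x. x\<^sup>2 * iexp (\<theta> * (x\<^sup>2 / 2)) \<partial>std_normal_distribution)
    = (\<integral>x. iexp (\<theta> * (x\<^sup>2 / 2)) \<partial>std_normal_distribution)"
proof -
  interpret N: real_distribution std_normal_distribution by (rule real_dist_normal_dist)
  let ?E = "\<lambda>x::real. std_normal_density x *\<^sub>R iexp (\<theta> * (x\<^sup>2 / 2))"
  let ?f = "\<lambda>x::real. ((1 - \<i> * \<theta>) * (of_real x)\<^sup>2 - 1) * ?E x"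
  let ?F = "\<lambda>x::real. - of_real x * ?E x"
  have i2: "integrable lborel (\<lambda>x. std_normal_density x *\<^sub>R (of_real (x\<^sup>2) * iexp (\<theta> * (x\<^sup>2 / 2))))"
    by (rule Bochner_Integration.integrable_bound[OF integrable_std_normal_moment[of 2]])
      (auto simp: norm_mult norm_power)
  have i0: "integrable lborel ?E"
    by (rule Bochner_Integration.integrable_bound[OF integrable_std_normal_moment[of 0]]) auto
  have int: "integrable lborel ?f"
  proof -
    have "?f = (\<lambda>x. (1 - \<i> * \<theta>) * (std_normal_density x *\<^sub>R (of_real (x\<^sup>2) * iexp (\<theta> * (x\<^sup>2 / 2)))) - ?E x)"
      by (auto simp: fun_eq_iff scaleR_conv_of_real algebra_simps)
    then show ?thesis
      by (simp only:) (intro Bochner_Integration.integrable_diff integrable_mult_right i0 i2)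
  qed
  have E: "?E x = of_real (1 / sqrt (2 * pi)) * exp (- ((1 - \<i> * \<theta>) * (of_real x)\<^sup>2 / 2))" for x
    by (simp add: std_normal_density_def scaleR_conv_of_real exp_of_real[symmetric] exp_add[symmetric]
        algebra_simps diff_divide_distrib)
  have "(LBINT x=-\<infinity>..\<infinity>. ?f x) = 0 - 0"
  proof (rule interval_integral_FTC_integrable)
    fix x :: real
    have aux: "((\<lambda>z. - z * (K * exp (- (c * z\<^sup>2 / 2)))) has_field_derivative
      (c * y\<^sup>2 - 1) * (K * exp (- (c * y\<^sup>2 / 2)))) (at y)" for c K y :: complex
      by (auto intro!: derivative_eq_intros simp: algebra_simps power2_eq_square)
    have "((\<lambda>z. - z * (of_real (1 / sqrt (2 * pi)) * exp (- ((1 - \<i> * \<theta>) * z\<^sup>2 / 2)))) has_field_derivative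
      ((1 - \<i> * \<theta>) * (of_real x)\<^sup>2 - 1) * (of_real (1 / sqrt (2 * pi)) * exp (- ((1 - \<i> * \<theta>) * (of_real x)\<^sup>2 / 2)))) (at (of_real x))"
      by (rule aux)
    then show "(?F has_vector_derivative ?f x) (at x)"
      unfolding E by (rule has_vector_derivative_real_field)
    show "isCont ?f x" unfolding E by (intro continuous_intros) simp_all
  next
    show "set_integrable lborel (einterval (-\<infinity>) \<infinity>) ?f"
      using int by (simp add: set_integrable_def)
    have lim: "((\<lambda>x. x * std_normal_density x) \<longlongrightarrow> 0) at_top" "((\<lambda>x. x * std_normal_density x) \<longlongrightarrow> 0) at_bot"
      unfolding std_normal_density_def by real_asymp+
    show "((?F \<circ> real_of_ereal) \<longlongrightarrow> 0) (at_right (-\<infinity>))"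
      unfolding ereal_tendsto_simps
      by (rule tendsto_norm_zero_cancel) (use tendsto_rabs_zero[OF lim(2)] in \<open>simp add: norm_mult abs_mult mult.commute\<close>)
    show "((?F \<circ> real_of_ereal) \<longlongrightarrow> 0) (at_left \<infinity>)"
      unfolding ereal_tendsto_simps
      by (rule tendsto_norm_zero_cancel) (use tendsto_rabs_zero[OF lim(1)] in \<open>simp add: norm_mult abs_mult mult.commute\<close>)
  qed simp
  then have "(\<integral>x. ?f x \<partial>lborel) = 0"
    by (simp add: interval_lebesgue_integral_def set_lebesgue_integral_def)
  moreover have "(\<integral>x. ?f x \<partial>lborel) = (1 - \<i> * \<theta>) * (\<integral>x. std_normal_density x *\<^sub>R (of_real (x\<^sup>2) * iexp (\<theta> * (x\<^sup>2 / 2))) \<partial>lborel)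
    - (\<integral>x. ?E x \<partial>lborel)"
  proof -
    have "?f = (\<lambda>x. (1 - \<i> * \<theta>) * (std_normal_density x *\<^sub>R (of_real (x\<^sup>2) * iexp (\<theta> * (x\<^sup>2 / 2)))) - ?E x)"
      by (auto simp: fun_eq_iff scaleR_conv_of_real algebra_simps)
    then show ?thesis
      by (simp only: Bochner_Integration.integral_diff integrable_mult_right i0 i2 integral_mult_right_zero)
  qed
  ultimately show ?thesis by (simp add: integral_density)
qed

text \<open>As a function of \<open>\<theta>\<close>, both sides solve \<open>h' = - \<theta> / (2 (1 - i \<theta>)) h\<close> with \<open>h(0) = 1\<close>; for the
  left-hand side the equation is the integration by parts above. The differential equation also settles
  which branch of \<open>(1 - i \<theta>)^(-1/2)\<close> occurs.\<close>

lemma expectation_iexp_half_square: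
  fixes \<theta> :: real
  shows "(\<integral>x. iexp (\<theta> * ((x\<^sup>2 - 1) / 2)) \<partial>std_normal_distribution) = exp (log_char_half_square \<theta>)"
proof -
  interpret N: real_distribution std_normal_distribution by (rule real_dist_normal_dist)
  let ?h = "\<lambda>\<theta>::real. \<integral>x. iexp (\<theta> * ((x\<^sup>2 - 1) / 2)) \<partial>std_normal_distribution"
  have i2: "integrable std_normal_distribution (\<lambda>x. x ^ k)" for k
    by (rule integrable_std_normal_distribution_moment)
  have "((\<lambda>\<theta>. ?h \<theta> * exp (- log_char_half_square \<theta>)) has_vector_derivative 0) (at t)" for t
  proof -
    have "(?h has_vector_derivative (\<integral>x. \<i> * of_real ((x\<^sup>2 - 1) / 2) * iexp (t * ((x\<^sup>2 - 1) / 2)) \<partial>std_normal_distribution)) (at t)"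
    proof (rule N.has_vector_derivative_expectation_iexp)
      have "(\<lambda>x::real. ((x\<^sup>2 - 1) / 2)\<^sup>2) = (\<lambda>x. (x ^ 4 - 2 * x ^ 2 + 1) / 4)"
        by (auto simp: fun_eq_iff power2_eq_square eval_nat_numeral algebra_simps)
      then show "integrable std_normal_distribution (\<lambda>x. ((x\<^sup>2 - 1) / 2)\<^sup>2)"
        using i2 by auto
    qed (use i2 in auto)
    moreover have "(\<integral>x. \<i> * of_real ((x\<^sup>2 - 1) / 2) * iexp (t * ((x\<^sup>2 - 1) / 2)) \<partial>std_normal_distribution)
      = - of_real t / (2 * (1 - \<i> * t)) * ?h t"
    proof -
      let ?a = "\<integral>x. x\<^sup>2 * iexp (t * (x\<^sup>2 / 2)) \<partial>std_normal_distribution"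
      let ?b = "\<integral>x. iexp (t * (x\<^sup>2 / 2)) \<partial>std_normal_distribution"
      have ia: "integrable std_normal_distribution (\<lambda>x. of_real (x\<^sup>2) * iexp (t * (x\<^sup>2 / 2)))"
        by (rule Bochner_Integration.integrable_bound[OF i2[of 2]]) (auto simp: norm_mult norm_power)
      have ib: "integrable std_normal_distribution (\<lambda>x. iexp (t * (x\<^sup>2 / 2)))"
        by (rule N.integrable_const_bound[where B = 1]) auto
      have split: "iexp (t * ((x\<^sup>2 - 1) / 2)) = iexp (- t / 2) * iexp (t * (x\<^sup>2 / 2))" for x
        by (simp add: exp_add[symmetric] algebra_simps diff_divide_distrib)
      have "(\<integral>x. \<i> * of_real ((x\<^sup>2 - 1) / 2) * iexp (t * ((x\<^sup>2 - 1) / 2)) \<partial>std_normal_distribution)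
        = (\<integral>x. (\<i> / 2 * iexp (- t / 2)) * (of_real (x\<^sup>2) * iexp (t * (x\<^sup>2 / 2)) - iexp (t * (x\<^sup>2 / 2))) \<partial>std_normal_distribution)"
        unfolding split by (intro Bochner_Integration.integral_cong) (auto simp: algebra_simps diff_divide_distrib)
      also have "\<dots> = (\<i> / 2 * iexp (- t / 2)) * (?a - ?b)"
        using ia ib by simp
      also have "?b = (1 - \<i> * t) * ?a" by (rule gaussian_complex_by_parts[symmetric])
      also have "(\<i> / 2 * iexp (- t / 2)) * (?a - (1 - \<i> * t) * ?a) = - of_real t / (2 * (1 - \<i> * t)) * (iexp (- t / 2) * ((1 - \<i> * t) * ?a))"
        using one_minus_i_times_real(2)[of t] by (simp add: field_simps)
      also have "(1 - \<i> * t) * ?a = ?b" by (rule gaussian_complex_by_parts)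
      also have "iexp (- t / 2) * ?b = ?h t" unfolding split by simp
      finally show ?thesis .
    qed
    ultimately have h: "(?h has_vector_derivative - of_real t / (2 * (1 - \<i> * t)) * ?h t) (at t)"
      by (rule has_vector_derivative_eq_rhs)
    have "(exp has_field_derivative exp (- log_char_half_square t)) (at (- log_char_half_square t))" by (rule DERIV_exp)
    from field_vector_diff_chain_at[OF has_vector_derivative_minus[OF log_char_half_square_derivative] this]
    have "((\<lambda>\<theta>. exp (- log_char_half_square \<theta>)) has_vector_derivative - (- of_real t / (2 * (1 - \<i> * t))) * exp (- log_char_half_square t)) (at t)"
      by (simp add: comp_def)
    from has_vector_derivative_mult[OF h this] show ?thesis by (simp add: algebra_simps)
  qed
  then obtain c where c: "\<And>\<theta>. ?h \<theta> * exp (- log_char_half_square \<theta>) = c"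
    using has_vector_derivative_zero_constant[of UNIV "\<lambda>\<theta>. ?h \<theta> * exp (- log_char_half_square \<theta>)"] by auto
  have "?h \<theta> * exp (- log_char_half_square \<theta>) = ?h 0 * exp (- log_char_half_square 0)" unfolding c ..
  also have "\<dots> = 1" by (simp add: log_char_half_square_def N.prob_space[simplified])
  finally show ?thesis by (simp add: exp_minus divide_simps)
qed

section \<open>Fourier inversion for integrable characteristic functions\<close>

lemma integrable_indicator_Icc: "integrable lborel (\<lambda>x. indicator {a..b} x * c :: real)" for a b :: real
  by (intro integrable_mult_left integrable_real_indicator) (auto simp: emeasure_lborel_Icc_eq)

lemma integral_iexp_Icc:
  fixes a b s :: real
  assumes "a \<le> b" "s \<noteq> 0"
  shows "(CLBINT x. indicator {a..b} x *\<^sub>R iexp (- (x * s))) = (iexp (- (s * a)) - iexp (- (s * b))) / (\<i> * s)"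
proof -
  have "((\<lambda>z. \<i> / s * exp (- (\<i> * s * z))) has_field_derivative iexp (- (x * s))) (at (of_real x))" for x
    using assms(2) by (auto intro!: derivative_eq_intros simp: mult_ac)
  then have "((\<lambda>x. \<i> / s * exp (- (\<i> * s * of_real x))) has_vector_derivative iexp (- (x * s))) (at x within S)" for x S
    by (rule has_vector_derivative_real_field)
  then have "(CLBINT x. indicator {a..b} x *\<^sub>R iexp (- (x * s)))
    = \<i> / s * exp (- (\<i> * s * of_real b)) - \<i> / s * exp (- (\<i> * s * of_real a))"
    by (intro integral_FTC_Icc[OF assms(1)] continuous_intros)
  also have "\<dots> = (exp (- (\<i> * s * of_real a)) - exp (- (\<i> * s * of_real b))) / (\<i> * s)"
  proof -
    have "\<i> / of_real s = - (1 / (\<i> * of_real s))" by (simp add: divide_inverse)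
    then show ?thesis by (simp add: diff_divide_distrib)
  qed
  finally show ?thesis by (simp add: mult_ac)
qed

context real_distribution
begin

text \<open>The candidate density. It is complex-valued by type; that it is real and non-negative is a consequence
  of being a density.\<close>

definition inverse_fourier :: "real \<Rightarrow> complex" where
  "inverse_fourier t = 1 / (2 * pi) * (CLBINT s. iexp (- (t * s)) * char M s)"

context
  assumes int_char: "integrable lborel (char M)"
begin

lemma integrable_iexp_char: "complex_integrable lborel (\<lambda>s. iexp (f s) * char M s)"
  if [measurable]: "f \<in> borel_measurable borel"
  by (rule Bochner_Integration.integrable_bound[OF int_char]) (auto simp: norm_mult)

lemma isCont_inverse_fourier: "isCont inverse_fourier t"
  unfolding continuous_at_sequentially comp_def inverse_fourier_def
  by (safe, intro tendsto_mult tendsto_const integral_dominated_convergence[where w = "\<lambda>s. norm (char M s)"])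
    (auto intro!: tendsto_intros integrable_norm int_char simp: norm_mult)

text \<open>Levy's inversion formula expresses the measure of the interval as a limit of truncated integrals. When
  the characteristic function is integrable, the truncation can be dropped, and by Fubini the kernel
  \<open>(exp (- i s a) - exp (- i s b)) / (i s)\<close>, being the integral of \<open>exp (- i x s)\<close> over \<open>[a, b]\<close>, can be
  moved outside.\<close>

lemma measure_Ioc_inverse_fourier_aux:
  assumes ab: "a \<le> b" and atoms: "measure M {a} = 0" "measure M {b} = 0"
  shows "of_real (measure M {a<..b}) = (CLBINT x. indicator {a..b} x *\<^sub>R inverse_fourier x)"
proof -
  let ?F = "\<lambda>s::real. (iexp (- (s * a)) - iexp (- (s * b))) / (\<i> * s) * char M s"
  have Fb: "norm (?F s) \<le> (b - a) * norm (char M s)" for s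
  proof (cases "s = 0")
    case False
    then have "norm ((iexp (- (s * a)) - iexp (- (s * b))) / (\<i> * s)) \<le> b - a"
      using Levy_Inversion_aux2[of "-b" "-a" s] ab by simp
    then show ?thesis unfolding norm_mult by (rule mult_right_mono) simp
  qed (use ab in simp)
  have intF: "complex_integrable lborel ?F"
    by (rule Bochner_Integration.integrable_bound[OF integrable_mult_right[OF integrable_norm[OF int_char], of "b - a"]])
      (use Fb ab in auto)
  have "(\<lambda>T. CLBINT t. indicator {- real T<..<real T} t *\<^sub>R ?F t) \<longlonglongrightarrow> (CLBINT t. ?F t)"
  proof (rule integral_dominated_convergence[where w = "\<lambda>t. norm (?F t)"])
    show "AE t in lborel. (\<lambda>T. indicator {- real T<..<real T} t *\<^sub>R ?F t) \<longlonglongrightarrow> ?F t"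
    proof (intro always_eventually allI)
      fix t :: real
      have "\<forall>\<^sub>F T in sequentially. \<bar>t\<bar> < real T" by real_asymp
      then have "\<forall>\<^sub>F T in sequentially. indicator {- real T<..<real T} t *\<^sub>R ?F t = ?F t"
        by eventually_elim (auto simp: indicator_def)
      then show "(\<lambda>T. indicator {- real T<..<real T} t *\<^sub>R ?F t) \<longlonglongrightarrow> ?F t"
        by (rule tendsto_eventually)
    qed
  qed (use intF in \<open>auto simp: indicator_def\<close>)
  moreover have "(CLBINT t=- real T..real T. ?F t) = (CLBINT t. indicator {- real T<..<real T} t *\<^sub>R ?F t)" for T
    by (simp add: interval_lebesgue_integral_def set_lebesgue_integral_def)
  ultimately have "(\<lambda>T. 1 / (2 * pi) * (CLBINT t=- real T..real T. ?F t)) \<longlonglongrightarrow> 1 / (2 * pi) * (CLBINT t. ?F t)"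
    by (simp only: tendsto_mult tendsto_const)
  moreover have "(\<lambda>T. 1 / (2 * pi) * (CLBINT t=- real T..real T. ?F t)) \<longlonglongrightarrow> measure M {a<..b}"
    using Levy_Inversion[OF ab atoms] by simp
  ultimately have "of_real (measure M {a<..b}) = 1 / (2 * pi) * (CLBINT t. ?F t)"
    by (rule LIMSEQ_unique[symmetric])
  also have "(CLBINT t. ?F t) = (CLBINT s. (CLBINT x. indicator {a..b} x *\<^sub>R iexp (- (x * s)) * char M s))"
  proof (rule integral_cong_AE)
    show "AE s in lborel. ?F s = (CLBINT x. indicator {a..b} x *\<^sub>R iexp (- (x * s)) * char M s)"
      using AE_lborel_singleton[of "0::real"]
      by eventually_elim (simp only: integral_mult_left_zero integral_iexp_Icc[OF ab] simp_thms)
  qed measurable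
  also have "\<dots> = (CLBINT x. (CLBINT s. indicator {a..b} x *\<^sub>R iexp (- (x * s)) * char M s))"
  proof (rule lborel_pair.Fubini_integral)
    have "integrable (lborel \<Otimes>\<^sub>M lborel) (\<lambda>(x, s). indicator {a..b} x * norm (char M s) :: real)"
    proof (rule lborel_pair.Fubini_integrable, goal_cases)
      case 2
      show ?case using integrable_indicator_Icc[of a b] by (simp add: abs_mult)
    next
      case 3
      show ?case using int_char by simp
    qed simp
    then show "complex_integrable (lborel \<Otimes>\<^sub>M lborel) (\<lambda>(x, s). indicator {a..b} x *\<^sub>R iexp (- (x * s)) * char M s)"
      by (rule Bochner_Integration.integrable_bound) (auto simp: norm_mult)
  qed
  also have "1 / (2 * pi) * \<dots> = (CLBINT x. indicator {a..b} x *\<^sub>R inverse_fourier x)"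
    by (simp add: inverse_fourier_def scaleR_conv_of_real mult.assoc flip: integral_mult_right_zero)
  finally show ?thesis .
qed

lemma norm_inverse_fourier_le: "norm (inverse_fourier t) \<le> 1 / (2 * pi) * (LBINT s. norm (char M s))"
proof -
  have pi: "norm (complex_of_real (1 / (2 * pi))) = 1 / (2 * pi)" by (simp only: norm_of_real) simp
  have "norm (CLBINT s. iexp (- (t * s)) * char M s) \<le> (LBINT s. norm (iexp (- (t * s)) * char M s))"
    by (rule integral_norm_bound)
  also have "\<dots> = (LBINT s. norm (char M s))" by (simp add: norm_mult)
  finally have "1 / (2 * pi) * norm (CLBINT s. iexp (- (t * s)) * char M s) \<le> 1 / (2 * pi) * (LBINT s. norm (char M s))"
    by (rule mult_left_mono) simp
  then show ?thesis unfolding inverse_fourier_def norm_mult by (simp only: pi)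
qed

lemma integrable_inverse_fourier_Icc: "complex_integrable lborel (\<lambda>x. indicator {a..b} x *\<^sub>R inverse_fourier x)"
  by (rule borel_integrable_compact[of "{a..b}" inverse_fourier, unfolded set_integrable_def])
    (auto intro!: continuous_at_imp_continuous_on isCont_inverse_fourier)

text \<open>By countability of the set of atoms, a point \<open>x\<close> lies in arbitrarily short intervals whose end points
  are not atoms. The inversion formula bounds the measure of such an interval by a constant times its
  length.\<close>

lemma no_atoms: "measure M {x} = 0"
proof (rule ccontr)
  assume "measure M {x} \<noteq> 0"
  then have pos: "0 < measure M {x}" by (simp add: zero_less_measure_iff)
  define C where "C = 1 / (2 * pi) * (LBINT s. norm (char M s))"
  have C: "0 \<le> C" by (simp add: C_def)
  \<comment> \<open>Chosen so that an interval of length \<open>2 \<epsilon>\<close> has measure at most half that of the supposed atom.\<close>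
  define \<epsilon> where "\<epsilon> = measure M {x} / (4 * (C + 1))"
  have \<epsilon>: "0 < \<epsilon>" using pos C by (simp add: \<epsilon>_def)
  have "\<exists>a\<in>{x - \<epsilon><..<x}. a \<notin> {x. 0 < measure M {x}}"
    using \<epsilon> by (intro open_minus_countable[OF countable_atoms]) auto
  then obtain a where a: "x - \<epsilon> < a" "a < x" "measure M {a} = 0"
    by (auto simp: zero_less_measure_iff)
  have "\<exists>b\<in>{x<..<x + \<epsilon>}. b \<notin> {x. 0 < measure M {x}}"
    using \<epsilon> by (intro open_minus_countable[OF countable_atoms]) auto
  then obtain b where b: "x < b" "b < x + \<epsilon>" "measure M {b} = 0"
    by (auto simp: zero_less_measure_iff)
  have "measure M {x} \<le> measure M {a<..b}" using a b by (intro finite_measure_mono) auto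
  also have "\<dots> = norm (CLBINT y. indicator {a..b} y *\<^sub>R inverse_fourier y)"
    using arg_cong[OF measure_Ioc_inverse_fourier_aux[of a b], of norm] a b by simp
  also have "\<dots> \<le> (LBINT y. norm (indicator {a..b} y *\<^sub>R inverse_fourier y))" by (rule integral_norm_bound)
  also have "\<dots> \<le> (LBINT y. indicator {a..b} y * C)"
  proof (rule integral_mono)
    show "integrable lborel (\<lambda>y. norm (indicator {a..b} y *\<^sub>R inverse_fourier y))"
      by (intro integrable_norm integrable_inverse_fourier_Icc)
    show "norm (indicator {a..b} y *\<^sub>R inverse_fourier y) \<le> indicator {a..b} y * C" for y
      using norm_inverse_fourier_le[of y] by (simp add: C_def indicator_def)
  qed (rule integrable_indicator_Icc)
  also have "\<dots> = (b - a) * C" using a b by simp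
  also have "\<dots> \<le> (2 * \<epsilon>) * (C + 1)" using a b C by (intro mult_mono) auto
  also have "\<dots> = measure M {x} / 2" using C by (simp add: \<epsilon>_def field_simps)
  finally show False using pos by simp
qed

lemma measure_Ioc_inverse_fourier:
  assumes "a \<le> b"
  shows "measure M {a<..b} = (LBINT x. indicator {a..b} x * Re (inverse_fourier x))"
proof -
  have "measure M {a<..b} = Re (CLBINT x. indicator {a..b} x *\<^sub>R inverse_fourier x)"
    by (simp add: measure_Ioc_inverse_fourier_aux[OF assms no_atoms no_atoms, symmetric])
  also have "\<dots> = (LBINT x. Re (indicator {a..b} x *\<^sub>R inverse_fourier x))"
    by (rule integral_Re[symmetric]) (rule integrable_inverse_fourier_Icc)
  finally show ?thesis by simp
qed

lemma integrable_Re_inverse_fourier_Icc: "integrable lborel (\<lambda>x. indicator {a..b} x * Re (inverse_fourier x))"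
  using integrable_Re[OF integrable_inverse_fourier_Icc[of a b]] by simp

text \<open>If the continuous function were negative at \<open>t\<close>, its integral over a short interval around \<open>t\<close>, which
  is the measure of that interval, would be negative.\<close>

lemma Re_inverse_fourier_nonneg: "0 \<le> Re (inverse_fourier t)"
proof (rule ccontr)
  let ?g = "\<lambda>t. Re (inverse_fourier t)"
  assume neg: "\<not> 0 \<le> ?g t"
  have "isCont ?g t" by (intro isCont_Re isCont_inverse_fourier)
  then have "\<exists>d>0. \<forall>y. dist y t < d \<longrightarrow> dist (?g y) (?g t) < - ?g t / 2"
    using neg unfolding continuous_at_eps_delta by (metis half_gt_zero neg_0_less_iff_less not_le dist_commute)
  then obtain d where d: "0 < d" and dg: "\<And>y. \<bar>y - t\<bar> < d \<Longrightarrow> \<bar>?g y - ?g t\<bar> < - ?g t / 2"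
    by (auto simp: dist_real_def)
  let ?a = "t - d / 2" and ?b = "t + d / 2"
  have "0 \<le> measure M {?a<..?b}" by simp
  also have "\<dots> = (LBINT x. indicator {?a..?b} x * ?g x)" using d by (intro measure_Ioc_inverse_fourier) simp
  also have "\<dots> \<le> (LBINT x. indicator {?a..?b} x * (?g t / 2))"
  proof (rule integral_mono)
    show "indicator {?a..?b} x * ?g x \<le> indicator {?a..?b} x * (?g t / 2)" for x
    proof (cases "x \<in> {?a..?b}")
      case True
      then have "\<bar>x - t\<bar> < d" using d by (auto simp: abs_if)
      from dg[OF this] show ?thesis using True by (simp add: abs_if split: if_splits)
    qed simp
  qed (rule integrable_Re_inverse_fourier_Icc integrable_indicator_Icc)+
  also have "\<dots> = d * (?g t / 2)" using d by simp
  also have "\<dots> < 0" using d neg by (simp add: mult_pos_neg)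
  finally show False by simp
qed

theorem density_inverse_fourier: "M = density lborel (\<lambda>x. ennreal (Re (inverse_fourier x)))"
proof (rule measure_eqI_generator_eq)
  let ?E = "range (\<lambda>(a, b). {a<..b::real})"
  let ?g = "\<lambda>t. Re (inverse_fourier t)"
  have g_meas [measurable]: "?g \<in> borel_measurable borel"
    by (intro borel_measurable_continuous_onI continuous_at_imp_continuous_on ballI isCont_Re isCont_inverse_fourier)
  show "Int_stable ?E" by (auto simp: Int_stable_def Int_greaterThanAtMost)
  show "?E \<subseteq> Pow UNIV" by auto
  show "sets M = sigma_sets UNIV ?E" "sets (density lborel (\<lambda>x. ennreal (?g x))) = sigma_sets UNIV ?E"
    by (simp_all add: borel_sigma_sets_Ioc)
  show "range (\<lambda>i. {- real i<..real i}) \<subseteq> ?E" by auto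
  show "(\<Union>i. {- real i<..real i}) = UNIV"
  proof -
    have "\<exists>i. - real i < x \<and> x \<le> real i" for x
    proof -
      obtain i where "\<bar>x\<bar> < real i" using reals_Archimedean2 by blast
      then show ?thesis by (intro exI[of _ i]) auto
    qed
    then show ?thesis by auto
  qed
  show "emeasure M {- real i<..real i} \<noteq> \<infinity>" for i by simp
  show "emeasure M X = emeasure (density lborel (\<lambda>x. ennreal (?g x))) X" if XE: "X \<in> ?E" for X
  proof -
    obtain a b where X: "X = {a<..b}" using XE by auto
    show ?thesis
    proof (cases "a \<le> b")
      case True
      have "emeasure (density lborel (\<lambda>x. ennreal (?g x))) X = (\<integral>\<^sup>+x. ennreal (indicator {a..b} x * ?g x) \<partial>lborel)"
        using AE_lborel_singleton[of a] unfolding X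
        by (subst emeasure_density) (auto intro!: nn_integral_cong_AE simp: indicator_def elim!: eventually_mono)
      also have "\<dots> = ennreal (LBINT x. indicator {a..b} x * ?g x)"
        by (intro nn_integral_eq_integral integrable_Re_inverse_fourier_Icc) (simp add: Re_inverse_fourier_nonneg)
      also have "\<dots> = emeasure M X"
        using True by (simp add: measure_Ioc_inverse_fourier[symmetric] X emeasure_eq_measure)
      finally show ?thesis by simp
    qed (simp add: X)
  qed
qed

end

end

section \<open>Distance of the density from the normal density\<close>

text \<open>The substitution \<open>w = 1 + c s^2\<close> turns the integrand on the half line into a difference of two powers
  of \<open>w\<close>; the condition \<open>p > 2\<close> makes their primitives vanish at infinity.\<close>

lemma has_bochner_integral_abs_cube_powr:
  fixes c p :: real
  assumes c: "0 < c" and p: "2 < p"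
  shows "has_bochner_integral lborel (\<lambda>s. \<bar>s\<bar> ^ 3 * (1 + c * s\<^sup>2) powr (- p)) (1 / (c\<^sup>2 * (p - 1) * (p - 2)))"
proof -
  let ?f = "\<lambda>s::real. \<bar>s\<bar> ^ 3 * (1 + c * s\<^sup>2) powr (- p)"
  let ?h = "\<lambda>s::real. s ^ 3 * (1 + c * s\<^sup>2) powr (- p)"
  let ?F = "\<lambda>s::real. ((1 + c * s\<^sup>2) powr (1 - p) / (p - 1) - (1 + c * s\<^sup>2) powr (2 - p) / (p - 2)) / (2 * c\<^sup>2)"
  have pos: "0 < 1 + c * s\<^sup>2" for s using c by (simp add: add_pos_nonneg)
  have half: "has_bochner_integral lborel (\<lambda>s. indicator {0..} s *\<^sub>R ?f s) (1 / (2 * c\<^sup>2 * (p - 1) * (p - 2)))"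
  proof (rule has_bochner_integral_nn_integral)
    have "(\<integral>\<^sup>+s. ennreal (?h s) * indicator {0..} s \<partial>lborel) = ennreal (0 - ?F 0)"
    proof (rule nn_integral_FTC_atLeast)
      show "(?F has_real_derivative ?h s) (at s)" if "0 \<le> s" for s
      proof -
        let ?w = "1 + c * s\<^sup>2"
        have "(?F has_real_derivative
            (((1 - p) * ?w powr (1 - p - 1) * (c * (2 * s))) / (p - 1)
            - ((2 - p) * ?w powr (2 - p - 1) * (c * (2 * s))) / (p - 2)) / (2 * c\<^sup>2)) (at s)"
        proof -
          have "((\<lambda>s. 1 + c * s\<^sup>2) has_real_derivative c * (2 * s)) (at s)"
            by (auto intro!: derivative_eq_intros)
          from DERIV_chain2[OF has_real_derivative_powr[OF pos] this]
          have "((\<lambda>s. (1 + c * s\<^sup>2) powr q) has_real_derivative q * ?w powr (q - 1) * (c * (2 * s))) (at s)" for q .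
          then show ?thesis by (intro DERIV_cdivide DERIV_diff)
        qed
        also have "(((1 - p) * ?w powr (1 - p - 1) * (c * (2 * s))) / (p - 1)
            - ((2 - p) * ?w powr (2 - p - 1) * (c * (2 * s))) / (p - 2)) / (2 * c\<^sup>2)
            = s / c * (?w powr (1 - p) - ?w powr (- p))"
        proof -
          have "(1 - p) / (p - 1) = -1" "(2 - p) / (p - 2) = -1" using p by (simp_all add: divide_eq_minus_1_iff)
          then have *: "((1 - p) * u * v) / (p - 1) = - (u * v)" "((2 - p) * u * v) / (p - 2) = - (u * v)" for u v
            by (metis mult.assoc mult_minus1 times_divide_eq_left)+
          show ?thesis unfolding * using c by (simp add: field_simps power2_eq_square)
        qed
        also have "?w powr (1 - p) = ?w * ?w powr (- p)" using pos[of s] by (simp add: powr_diff powr_minus divide_inverse)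
        also have "s / c * (?w * ?w powr (- p) - ?w powr (- p)) = ?h s"
          using c by (simp add: field_simps power2_eq_square power3_eq_cube)
        finally show ?thesis .
      qed
      have *: "((\<lambda>s. (1 + c * s\<^sup>2) powr (- q)) \<longlongrightarrow> 0) at_top" if "0 < q" for q
        using c that by real_asymp
      have "((\<lambda>s. (1 + c * s\<^sup>2) powr (1 - p)) \<longlongrightarrow> 0) at_top" "((\<lambda>s. (1 + c * s\<^sup>2) powr (2 - p)) \<longlongrightarrow> 0) at_top"
        using *[of "p - 1"] *[of "p - 2"] p by simp_all
      then have "(?F \<longlongrightarrow> (0 / (p - 1) - 0 / (p - 2)) / (2 * c\<^sup>2)) at_top"
        using p c by (intro tendsto_divide tendsto_diff tendsto_const) simp_all
      then show "(?F \<longlongrightarrow> 0) at_top" by simp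
    qed auto
    also have "0 - ?F 0 = 1 / (2 * c\<^sup>2 * (p - 1) * (p - 2))"
      using p c by (simp add: field_simps)
    finally show "(\<integral>\<^sup>+s. ennreal (indicator {0..} s *\<^sub>R ?f s) \<partial>lborel) = ennreal (1 / (2 * c\<^sup>2 * (p - 1) * (p - 2)))"
      by (subst (asm) nn_integral_cong[where v = "\<lambda>s. ennreal (indicator {0..} s *\<^sub>R ?f s)"])
        (auto simp: indicator_def)
  qed (use p in \<open>auto simp: indicator_def\<close>)
  from has_bochner_integral_even_function[OF this] show ?thesis by (simp add: mult.assoc)
qed

lemma has_bochner_integral_abs_cube_gauss:
  "has_bochner_integral lborel (\<lambda>s::real. \<bar>s\<bar> ^ 3 * exp (- s\<^sup>2 / 2)) 4"
proof -
  have "has_bochner_integral lborel (\<lambda>s. sqrt (2 * pi) * (std_normal_density s * \<bar>s\<bar> ^ (2 * 1 + 1)))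
    (sqrt (2 * pi) * (sqrt (2 / pi) * 2 ^ 1 * fact 1))"
    by (intro has_bochner_integral_mult_right std_normal_moment_abs_odd)
  moreover have "sqrt (2 * pi) * (std_normal_density s * \<bar>s\<bar> ^ (2 * 1 + 1)) = \<bar>s\<bar> ^ 3 * exp (- s\<^sup>2 / 2)" for s :: real
    by (simp add: std_normal_density_def eval_nat_numeral)
  moreover have "sqrt (2 * pi) * (sqrt (2 / pi) * 2 ^ 1 * fact 1) = 4"
    by (simp add: real_sqrt_mult[symmetric])
  ultimately show ?thesis by (simp only:)
qed

text \<open>The characteristic function of \<open>\<Sum>\<^sub>i l\<^sub>i (X\<^sub>i^2 - 1) / 2\<close> for independent standard normal \<open>X\<^sub>i\<close>; see
  \<open>char_quadratic_form\<close>.\<close>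

definition quad_char :: "('n::finite \<Rightarrow> real) \<Rightarrow> real \<Rightarrow> complex" where
  "quad_char l s = (\<Prod>i\<in>UNIV. exp (log_char_half_square (l i * s)))"

text \<open>Write \<open>l\<^sub>i^2 = \<theta>\<^sub>i 2 a^2\<close> with \<open>0 \<le> \<theta>\<^sub>i \<le> 1\<close>. Concavity bounds each \<open>ln (1 + l\<^sub>i^2 s^2)\<close> below by
  \<open>\<theta>\<^sub>i ln (1 + 2 a^2 s^2)\<close>, and the weights \<open>\<theta>\<^sub>i\<close> add up to \<open>1 / a^2\<close>.\<close>

lemma norm_quad_char_le:
  fixes l :: "'n::finite \<Rightarrow> real"
  assumes l2: "(\<Sum>i\<in>UNIV. (l i)\<^sup>2) = 2" and a: "0 < a" and la: "\<And>i. (l i)\<^sup>2 \<le> 2 * a\<^sup>2"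
  shows "norm (quad_char l s) \<le> (1 + 2 * a\<^sup>2 * s\<^sup>2) powr (- (1 / (4 * a\<^sup>2)))"
proof -
  let ?L = "ln (1 + 2 * a\<^sup>2 * s\<^sup>2)"
  have "1 / (4 * a\<^sup>2) * ?L = (\<Sum>i\<in>UNIV. 1 / 4 * ((l i)\<^sup>2 / (2 * a\<^sup>2) * ?L))"
    unfolding sum_distrib_left[symmetric] sum_distrib_right[symmetric] sum_divide_distrib[symmetric] l2
    using a by simp
  also have "\<dots> \<le> (\<Sum>i\<in>UNIV. 1 / 4 * ln (1 + (l i * s)\<^sup>2))"
  proof (intro sum_mono mult_left_mono)
    fix i
    have "(l i)\<^sup>2 / (2 * a\<^sup>2) * ?L \<le> ln (1 + (l i)\<^sup>2 / (2 * a\<^sup>2) * (2 * a\<^sup>2 * s\<^sup>2))"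
      using a la[of i] by (intro ln_one_plus_scaled_ge) (auto simp: field_simps)
    also have "(l i)\<^sup>2 / (2 * a\<^sup>2) * (2 * a\<^sup>2 * s\<^sup>2) = (l i * s)\<^sup>2"
      using a by (simp add: power_mult_distrib)
    finally show "(l i)\<^sup>2 / (2 * a\<^sup>2) * ?L \<le> ln (1 + (l i * s)\<^sup>2)" .
  qed simp
  finally have le: "- (\<Sum>i\<in>UNIV. 1 / 4 * ln (1 + (l i * s)\<^sup>2)) \<le> - (1 / (4 * a\<^sup>2) * ?L)" by simp
  have "norm (quad_char l s) = (\<Prod>i\<in>UNIV. exp (- (1 / 4 * ln (1 + (l i * s)\<^sup>2))))"
    unfolding quad_char_def prod_norm[symmetric] norm_exp_eq_Re exp_Re_log_char_half_square
    by (intro prod.cong refl) (auto simp: powr_def add_nonneg_eq_0_iff)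
  also have "\<dots> = exp (- (\<Sum>i\<in>UNIV. 1 / 4 * ln (1 + (l i * s)\<^sup>2)))"
    by (simp add: exp_sum[symmetric] sum_negf)
  also have "\<dots> \<le> exp (- (1 / (4 * a\<^sup>2) * ?L))" using le by simp
  also have "\<dots> = (1 + 2 * a\<^sup>2 * s\<^sup>2) powr (- (1 / (4 * a\<^sup>2)))"
    by (simp add: powr_def add_nonneg_eq_0_iff)
  finally show ?thesis .
qed

text \<open>The quadratic terms of the exponents add up to exactly \<open>- s^2 / 2\<close>, and the cubic remainders to at most
  \<open>max \<bar>l\<^sub>i\<bar> \<cdot> (\<Sum>\<^sub>i l\<^sub>i^2) \<cdot> \<bar>s\<bar>^3 / 6\<close>.\<close>

lemma quad_char_normal_diff_le:
  fixes l :: "'n::finite \<Rightarrow> real"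
  assumes l2: "(\<Sum>i\<in>UNIV. (l i)\<^sup>2) = 2" and a: "0 < a" and la: "\<And>i. (l i)\<^sup>2 \<le> 2 * a\<^sup>2"
  shows "norm (quad_char l s - exp (- (of_real s)\<^sup>2 / 2))
    \<le> sqrt 2 * a / 6 * \<bar>s\<bar> ^ 3 * (norm (quad_char l s) + exp (- s\<^sup>2 / 2))"
proof -
  let ?u = "\<Sum>i\<in>UNIV. log_char_half_square (l i * s)" and ?w = "- (of_real s)\<^sup>2 / 2 :: complex"
  have u: "quad_char l s = exp ?u" by (simp add: quad_char_def exp_sum)
  have w: "?w = - (\<Sum>i\<in>UNIV. (of_real (l i * s))\<^sup>2 / 4)"
  proof -
    have "(\<Sum>i\<in>UNIV. (l i * s)\<^sup>2 / 4) = s\<^sup>2 / 2"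
      unfolding power_mult_distrib sum_divide_distrib[symmetric] sum_distrib_right[symmetric] l2 by simp
    then have "complex_of_real (\<Sum>i\<in>UNIV. (l i * s)\<^sup>2 / 4) = of_real (s\<^sup>2 / 2)" by (simp only:)
    then have "(\<Sum>i\<in>UNIV. (complex_of_real (l i * s))\<^sup>2 / 4) = (of_real s)\<^sup>2 / 2"
      by (simp only: of_real_sum of_real_divide of_real_power of_real_numeral)
    then show ?thesis by (simp only: minus_divide_left)
  qed
  have "norm (?u - ?w) = norm (\<Sum>i\<in>UNIV. log_char_half_square (l i * s) + (of_real (l i * s))\<^sup>2 / 4)"
    unfolding w by (simp add: sum.distrib)
  also have "\<dots> \<le> (\<Sum>i\<in>UNIV. \<bar>l i * s\<bar> ^ 3 / 6)"
    by (rule order_trans[OF norm_sum sum_mono]) (rule log_char_half_square_approx)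
  also have "\<dots> \<le> (\<Sum>i\<in>UNIV. (l i)\<^sup>2 * (sqrt 2 * a * \<bar>s\<bar> ^ 3 / 6))"
  proof (rule sum_mono)
    fix i
    have "\<bar>l i\<bar> \<le> sqrt 2 * a"
      using la[of i] a real_le_rsqrt[of "\<bar>l i\<bar>" "2 * a\<^sup>2"] by (simp add: real_sqrt_mult)
    then have "(l i)\<^sup>2 * \<bar>l i\<bar> \<le> (l i)\<^sup>2 * (sqrt 2 * a)" by (rule mult_left_mono) simp
    then have "(l i)\<^sup>2 * \<bar>l i\<bar> * (\<bar>s\<bar> ^ 3 / 6) \<le> (l i)\<^sup>2 * (sqrt 2 * a) * (\<bar>s\<bar> ^ 3 / 6)"
      by (rule mult_right_mono) simp
    moreover have "\<bar>l i * s\<bar> ^ 3 / 6 = (l i)\<^sup>2 * \<bar>l i\<bar> * (\<bar>s\<bar> ^ 3 / 6)"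
    proof -
      have "\<bar>l i\<bar> ^ 3 = (l i)\<^sup>2 * \<bar>l i\<bar>" by (metis power2_abs power2_eq_square power3_eq_cube)
      then show ?thesis by (simp add: abs_mult power_mult_distrib)
    qed
    ultimately show "\<bar>l i * s\<bar> ^ 3 / 6 \<le> (l i)\<^sup>2 * (sqrt 2 * a * \<bar>s\<bar> ^ 3 / 6)" by (simp add: mult.assoc)
  qed
  also have "\<dots> = sqrt 2 * a * \<bar>s\<bar> ^ 3 / 3" unfolding sum_distrib_right[symmetric] l2 by simp
  finally have uw: "norm (?u - ?w) \<le> sqrt 2 * a * \<bar>s\<bar> ^ 3 / 3" .
  have nu: "exp (Re ?u) = norm (quad_char l s)" unfolding u norm_exp_eq_Re ..
  have nw: "exp (Re ?w) = exp (- s\<^sup>2 / 2)" by (simp flip: of_real_power)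
  have "norm (quad_char l s - exp ?w) \<le> norm (?u - ?w) * (exp (Re ?u) + exp (Re ?w)) / 2"
    unfolding u by (rule norm_exp_diff_le)
  also have "\<dots> \<le> (sqrt 2 * a * \<bar>s\<bar> ^ 3 / 3) * (exp (Re ?u) + exp (Re ?w)) / 2"
    by (intro divide_right_mono mult_right_mono uw) (simp_all add: add_nonneg_nonneg)
  finally show ?thesis unfolding nu nw by (simp add: algebra_simps)
qed

text \<open>With \<open>d = 1 - 8 a^2\<close> one has \<open>1 - 4 a^2 = (1 + d) / 2\<close>, and \<open>sqrt 2 / (3 \<pi>)\<close> is slightly above
  \<open>0.150\<close>. Replacing it by \<open>0.151\<close> and clearing denominators leaves a cubic polynomial in \<open>d\<close> whose
  minimum on the positive axis, near \<open>d = 0.234\<close>, is about \<open>0.007\<close>.\<close>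

lemma density_bound_constants:
  fixes a :: real
  assumes a: "0 < a" "a\<^sup>2 < 1 / 8"
  shows "1 / (2 * pi) * (sqrt 2 * a / 6 * (4 / ((1 - 4 * a\<^sup>2) * (1 - 8 * a\<^sup>2)) + 4))
    \<le> 0.14 * (4 + 0.29 / (1 - 8 * a\<^sup>2)\<^sup>2) * a"
proof -
  define d where "d = 1 - 8 * a\<^sup>2"
  have d: "0 < d" "d < 1" using a by (simp_all add: d_def)
  have d4: "1 - 4 * a\<^sup>2 = (1 + d) / 2" by (simp add: d_def)
  have "sqrt 2 \<le> sqrt (1.4143\<^sup>2)" unfolding real_sqrt_le_iff by (simp add: power2_eq_square)
  then have s2: "sqrt 2 \<le> 1.4143" by (simp only: real_sqrt_abs) simp
  have "3.1415 < pi" using pi_approx by simp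
  then have k: "sqrt 2 / (3 * pi) \<le> 0.151" using s2 by (simp add: pos_divide_le_eq)
  have cubic: "0 \<le> 0.409 * d ^ 3 + 0.409 * d\<^sup>2 - 0.2614 * d + 0.0406"
  proof -
    \<comment> \<open>Squares centred near the minimum; the two leftover terms have positive coefficients.\<close>
    have "0.409 * d ^ 3 + 0.409 * d\<^sup>2 - 0.2614 * d + 0.0406
      = 0.409 * d * (d - 0.25)\<^sup>2 + 0.6135 * (d - 0.234)\<^sup>2 + 0.0001555 * d + 0.007007194"
      by (simp add: power2_eq_square power3_eq_cube field_simps)
    also have "0 \<le> \<dots>" using d by (intro add_nonneg_nonneg mult_nonneg_nonneg) simp_all
    finally show ?thesis .
  qed
  have main: "0.151 * (2 / ((1 + d) * d) + 1) \<le> 0.14 * (4 + 0.29 / d\<^sup>2)"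
  proof -
    have "0.14 * (4 + 0.29 / d\<^sup>2) - 0.151 * (2 / ((1 + d) * d) + 1)
      = (0.409 * d ^ 3 + 0.409 * d\<^sup>2 - 0.2614 * d + 0.0406) / (d\<^sup>2 * (1 + d))"
      using d by (simp add: divide_simps) (simp add: algebra_simps power2_eq_square power3_eq_cube)
    also have "0 \<le> \<dots>" using d cubic by simp
    finally show ?thesis by simp
  qed
  have "1 / (2 * pi) * (sqrt 2 * a / 6 * (4 / ((1 - 4 * a\<^sup>2) * (1 - 8 * a\<^sup>2)) + 4))
    = a * (sqrt 2 / (3 * pi) * (2 / ((1 + d) * d) + 1))"
    unfolding d4 d_def[symmetric] by (simp add: field_simps)
  also have "\<dots> \<le> a * (0.151 * (2 / ((1 + d) * d) + 1))"
    using a d by (intro mult_left_mono mult_right_mono k) simp_all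
  also have "\<dots> \<le> a * (0.14 * (4 + 0.29 / d\<^sup>2))"
    using a main by (intro mult_left_mono) simp_all
  finally show ?thesis by (simp add: d_def mult_ac)
qed

text \<open>The standard normal density is, up to scaling, its own Fourier transform, so the known characteristic
  function of the normal law already is the inversion formula.\<close>

lemma std_normal_density_inverse_fourier:
  "of_real (std_normal_density t) = 1 / (2 * pi) * (CLBINT s. iexp (- (t * s)) * exp (- (of_real s)\<^sup>2 / 2))"
proof -
  have "exp (- (t\<^sup>2) / 2) = char std_normal_distribution (- t)"
    by (simp add: char_std_normal_distribution)
  also have "\<dots> = (CLBINT s. std_normal_density s *\<^sub>R iexp (- t * s))"
    unfolding char_def by (simp add: integral_density)
  also have "\<dots> = (CLBINT s. of_real (1 / sqrt (2 * pi)) * (iexp (- (t * s)) * exp (- (of_real s)\<^sup>2 / 2)))"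
    by (intro Bochner_Integration.integral_cong)
      (simp_all add: std_normal_density_def scaleR_conv_of_real exp_of_real[symmetric])
  also have "\<dots> = of_real (1 / sqrt (2 * pi)) * (CLBINT s. iexp (- (t * s)) * exp (- (of_real s)\<^sup>2 / 2))"
    by (rule integral_mult_right_zero)
  finally have "of_real (1 / sqrt (2 * pi)) * of_real (exp (- (t\<^sup>2) / 2)) =
    of_real (1 / sqrt (2 * pi)) * (of_real (1 / sqrt (2 * pi)) * (CLBINT s. iexp (- (t * s)) * exp (- (of_real s)\<^sup>2 / 2)))"
    by simp
  also have "\<dots> = of_real (1 / sqrt (2 * pi) * (1 / sqrt (2 * pi))) * (CLBINT s. iexp (- (t * s)) * exp (- (of_real s)\<^sup>2 / 2))"
    by (simp only: of_real_mult mult.assoc)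
  also have "1 / sqrt (2 * pi) * (1 / sqrt (2 * pi)) = 1 / (2 * pi)" by simp
  finally show ?thesis by (simp add: std_normal_density_def)
qed

context real_distribution
begin

lemma abs_inverse_fourier_diff_normal_le:
  assumes int: "integrable lborel (char M)"
  shows "\<bar>Re (inverse_fourier t) - std_normal_density t\<bar>
    \<le> 1 / (2 * pi) * (LBINT s. norm (char M s - exp (- (of_real s)\<^sup>2 / 2)))"
proof -
  have gauss: "complex_integrable lborel (\<lambda>s. exp (- (of_real s)\<^sup>2 / 2))"
  proof -
    have "integrable lborel (\<lambda>s. sqrt (2 * pi) * std_normal_density s)"
      using integrable_std_normal_moment[of 0] by simp
    then show ?thesis
      by (rule Bochner_Integration.integrable_bound)
        (auto simp: std_normal_density_def simp flip: of_real_power)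
  qed
  have gi: "complex_integrable lborel (\<lambda>s. iexp (- (t * s)) * exp (- (of_real s)\<^sup>2 / 2))"
    by (rule Bochner_Integration.integrable_bound[OF gauss]) (auto simp: norm_mult)
  have "inverse_fourier t - of_real (std_normal_density t)
    = 1 / (2 * pi) * ((CLBINT s. iexp (- (t * s)) * char M s) - (CLBINT s. iexp (- (t * s)) * exp (- (of_real s)\<^sup>2 / 2)))"
    unfolding inverse_fourier_def std_normal_density_inverse_fourier by (simp only: right_diff_distrib)
  also have "(CLBINT s. iexp (- (t * s)) * char M s) - (CLBINT s. iexp (- (t * s)) * exp (- (of_real s)\<^sup>2 / 2))
    = (CLBINT s. iexp (- (t * s)) * (char M s - exp (- (of_real s)\<^sup>2 / 2)))"
    unfolding right_diff_distrib
    by (rule Bochner_Integration.integral_diff[symmetric, OF integrable_iexp_char[OF int] gi]) simp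
  finally have "norm (inverse_fourier t - of_real (std_normal_density t))
    = norm (complex_of_real (1 / (2 * pi))) * norm (CLBINT s. iexp (- (t * s)) * (char M s - exp (- (of_real s)\<^sup>2 / 2)))"
    by (simp only: norm_mult of_real_divide of_real_1)
  also have "norm (complex_of_real (1 / (2 * pi))) = 1 / (2 * pi)" by (simp only: norm_of_real) simp
  also have "1 / (2 * pi) * norm (CLBINT s. iexp (- (t * s)) * (char M s - exp (- (of_real s)\<^sup>2 / 2)))
    \<le> 1 / (2 * pi) * (LBINT s. norm (iexp (- (t * s)) * (char M s - exp (- (of_real s)\<^sup>2 / 2))))"
    by (intro mult_left_mono integral_norm_bound) simp
  finally have "norm (inverse_fourier t - of_real (std_normal_density t))
    \<le> 1 / (2 * pi) * (LBINT s. norm (char M s - exp (- (of_real s)\<^sup>2 / 2)))"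
    by (simp add: norm_mult)
  then show ?thesis using abs_Re_le_cmod[of "inverse_fourier t - of_real (std_normal_density t)"] by simp
qed

text \<open>Integrate the pointwise estimate of the difference of the characteristic functions. The same power
  bound yields integrability of the characteristic function: near the origin the modulus is at most one,
  and elsewhere the factor \<open>\<bar>s\<bar>^3\<close> only enlarges the bound.\<close>

lemma quad_char_density_bound:
  fixes l :: "'n::finite \<Rightarrow> real"
  assumes char: "char M = quad_char l"
    and l2: "(\<Sum>i\<in>UNIV. (l i)\<^sup>2) = 2" and a: "0 < a" "a\<^sup>2 < 1 / 8" and la: "\<And>i. (l i)\<^sup>2 \<le> 2 * a\<^sup>2"
  shows "integrable lborel (char M)"
    and "\<bar>Re (inverse_fourier t) - std_normal_density t\<bar> \<le> 0.14 * (4 + 0.29 / (1 - 8 * a\<^sup>2)\<^sup>2) * a"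
proof -
  let ?b = "\<lambda>s::real. (1 + 2 * a\<^sup>2 * s\<^sup>2) powr (- (1 / (4 * a\<^sup>2)))"
  define I where "I = 4 / ((1 - 4 * a\<^sup>2) * (1 - 8 * a\<^sup>2))"
  have hb: "has_bochner_integral lborel (\<lambda>s. \<bar>s\<bar> ^ 3 * ?b s) I"
  proof -
    have "1 / ((2 * a\<^sup>2)\<^sup>2 * (1 / (4 * a\<^sup>2) - 1) * (1 / (4 * a\<^sup>2) - 2)) = I"
    proof -
      have "1 / (4 * a\<^sup>2) - 1 = (1 - 4 * a\<^sup>2) / (4 * a\<^sup>2)" "1 / (4 * a\<^sup>2) - 2 = (1 - 8 * a\<^sup>2) / (4 * a\<^sup>2)"
        using a by (simp_all add: field_simps)
      then show ?thesis using a by (simp add: I_def power2_eq_square)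
    qed
    then show ?thesis
      using has_bochner_integral_abs_cube_powr[of "2 * a\<^sup>2" "1 / (4 * a\<^sup>2)"] a
      by (simp add: field_simps)
  qed
  have nb: "norm (char M s) \<le> ?b s" for s unfolding char by (rule norm_quad_char_le[OF l2 a(1) la])
  show int: "integrable lborel (char M)"
  proof (rule Bochner_Integration.integrable_bound)
    show "integrable lborel (\<lambda>s. indicator {-1..1} s * 1 + \<bar>s\<bar> ^ 3 * ?b s)"
      using hb by (intro Bochner_Integration.integrable_add integrable_indicator_Icc) (auto simp: has_bochner_integral_iff)
    show "AE s in lborel. norm (char M s) \<le> norm (indicator {-1..1} s * 1 + \<bar>s\<bar> ^ 3 * ?b s)"
    proof (intro always_eventually allI)
      fix s :: real
      have "norm (char M s) \<le> indicator {-1..1} s * 1 + \<bar>s\<bar> ^ 3 * ?b s"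
      proof (cases "s \<in> {-1..1}")
        case True then show ?thesis using cmod_char_le_1[of s] by (simp add: add_increasing2)
      next
        case False
        then have "1 \<le> \<bar>s\<bar> ^ 3" by (intro one_le_power) auto
        then have "1 * ?b s \<le> \<bar>s\<bar> ^ 3 * ?b s" by (intro mult_right_mono) auto
        then show ?thesis using nb[of s] False by simp
      qed
      then show "norm (char M s) \<le> norm (indicator {-1..1} s * 1 + \<bar>s\<bar> ^ 3 * ?b s)" by simp
    qed
  qed measurable
  have "(LBINT s. norm (char M s - exp (- (of_real s)\<^sup>2 / 2)))
    \<le> (LBINT s. sqrt 2 * a / 6 * (\<bar>s\<bar> ^ 3 * ?b s + \<bar>s\<bar> ^ 3 * exp (- s\<^sup>2 / 2)))"
  proof (rule integral_mono')
    show "integrable lborel (\<lambda>s. sqrt 2 * a / 6 * (\<bar>s\<bar> ^ 3 * ?b s + \<bar>s\<bar> ^ 3 * exp (- s\<^sup>2 / 2)))"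
      using hb has_bochner_integral_abs_cube_gauss
      by (intro integrable_mult_right Bochner_Integration.integrable_add) (auto simp: has_bochner_integral_iff)
    show "norm (char M s - exp (- (of_real s)\<^sup>2 / 2)) \<le> sqrt 2 * a / 6 * (\<bar>s\<bar> ^ 3 * ?b s + \<bar>s\<bar> ^ 3 * exp (- s\<^sup>2 / 2))" for s
    proof -
      have "norm (char M s - exp (- (of_real s)\<^sup>2 / 2)) \<le> sqrt 2 * a / 6 * \<bar>s\<bar> ^ 3 * (norm (char M s) + exp (- s\<^sup>2 / 2))"
        unfolding char by (rule quad_char_normal_diff_le[OF l2 a(1) la])
      also have "\<dots> \<le> sqrt 2 * a / 6 * \<bar>s\<bar> ^ 3 * (?b s + exp (- s\<^sup>2 / 2))"
        using a nb[of s] by (intro mult_left_mono add_right_mono) auto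
      finally show ?thesis by (simp add: algebra_simps)
    qed
  qed (use a in \<open>auto intro!: mult_nonneg_nonneg add_nonneg_nonneg\<close>)
  also have "\<dots> = sqrt 2 * a / 6 * (I + 4)"
    by (intro has_bochner_integral_integral_eq has_bochner_integral_mult_right has_bochner_integral_add
        hb has_bochner_integral_abs_cube_gauss)
  finally have "1 / (2 * pi) * (LBINT s. norm (char M s - exp (- (of_real s)\<^sup>2 / 2)))
    \<le> 1 / (2 * pi) * (sqrt 2 * a / 6 * (I + 4))" by (intro mult_left_mono) simp_all
  also have "\<dots> \<le> 0.14 * (4 + 0.29 / (1 - 8 * a\<^sup>2)\<^sup>2) * a"
    unfolding I_def by (rule density_bound_constants[OF a])
  finally show "\<bar>Re (inverse_fourier t) - std_normal_density t\<bar> \<le> 0.14 * (4 + 0.29 / (1 - 8 * a\<^sup>2)\<^sup>2) * a"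
    using abs_inverse_fourier_diff_normal_le[OF int, of t] by simp
qed

end

section \<open>Score and Fisher information\<close>

lemma transpose_add: "transpose (A + B) = transpose A + transpose B"
  by (simp add: transpose_def vec_eq_iff)

lemma transpose_sum_scaleR:
  "transpose (\<Sum>j\<in>J. c j *\<^sub>R A j) = (\<Sum>j\<in>J. c j *\<^sub>R transpose (A j))" for A :: "'j \<Rightarrow> real ^ 'n ^ 'm"
  by (simp add: transpose_def vec_eq_iff)

lemma trace_sum_scaleR_mult:
  fixes A :: "'r::finite \<Rightarrow> real ^ 'n ^ 'n"
  shows "trace ((\<Sum>i\<in>UNIV. x $ i *\<^sub>R A i) ** (\<Sum>j\<in>UNIV. x $ j *\<^sub>R A j))
    = x \<bullet> ((\<chi> i j. trace (A i ** A j)) *v x)"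
proof -
  have "trace ((\<Sum>i\<in>UNIV. x $ i *\<^sub>R A i) ** (\<Sum>j\<in>UNIV. x $ j *\<^sub>R A j))
    = (\<Sum>p\<in>UNIV. \<Sum>k\<in>UNIV. (\<Sum>i\<in>UNIV. \<Sum>j\<in>UNIV. x $ i * A i $ p $ k * (x $ j * A j $ k $ p)))"
    by (simp add: trace_def matrix_matrix_mult_def sum_product)
  also have "\<dots> = (\<Sum>p\<in>UNIV. \<Sum>i\<in>UNIV. \<Sum>k\<in>UNIV. \<Sum>j\<in>UNIV. x $ i * A i $ p $ k * (x $ j * A j $ k $ p))"
    by (intro sum.cong refl sum.swap)
  also have "\<dots> = (\<Sum>i\<in>UNIV. \<Sum>p\<in>UNIV. \<Sum>k\<in>UNIV. \<Sum>j\<in>UNIV. x $ i * A i $ p $ k * (x $ j * A j $ k $ p))"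
    by (rule sum.swap)
  also have "\<dots> = (\<Sum>i\<in>UNIV. \<Sum>p\<in>UNIV. \<Sum>j\<in>UNIV. \<Sum>k\<in>UNIV. x $ i * A i $ p $ k * (x $ j * A j $ k $ p))"
    by (intro sum.cong refl sum.swap)
  also have "\<dots> = (\<Sum>i\<in>UNIV. \<Sum>j\<in>UNIV. \<Sum>p\<in>UNIV. \<Sum>k\<in>UNIV. x $ i * A i $ p $ k * (x $ j * A j $ k $ p))"
    by (intro sum.cong refl sum.swap)
  also have "\<dots> = x \<bullet> ((\<chi> i j. trace (A i ** A j)) *v x)"
    by (simp add: inner_vec_def matrix_vector_mult_def trace_def matrix_matrix_mult_def sum_distrib_left
        sum_distrib_right mult_ac)
  finally show ?thesis .
qed

lemma trace_sum_scaleR: "trace (\<Sum>j\<in>J. c j *\<^sub>R A j) = (\<Sum>j\<in>J. c j * trace (A j))" for A :: "'j \<Rightarrow> real ^ 'n ^ 'n"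
  unfolding trace_def by (simp add: sum_distrib_left) (rule sum.swap)

lemma sum_scaleR_matrix_vector: "(\<Sum>j\<in>J. c j *\<^sub>R A j) *v x = (\<Sum>j\<in>J. c j *\<^sub>R (A j *v x))" for A :: "'j \<Rightarrow> real ^ 'n ^ 'm"
  by (induction J rule: infinite_finite_induct)
    (simp_all add: matrix_vector_mult_add_rdistrib scaleR_matrix_vector_assoc)

text \<open>The error variance \<open>\<psi>\<^sub>e > 0\<close> bounds the quadratic form of \<open>\<Sigma>(\<psi>)\<close> below by \<open>\<psi>\<^sub>e (x \<bullet> x)\<close>.\<close>

lemma cov_pos_semidef_invertible:
  fixes Z :: "real ^ 'q ^ 'n"
  assumes \<psi>: "\<psi> \<in> param_set P e"
  shows "pos_semidef (cov Z P e \<psi>)" "invertible (cov Z P e \<psi>)"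
proof -
  let ?V = "cov Z P e \<psi>"
  have Psi: "transpose (Psi P \<psi>) = Psi P \<psi>" "\<And>x. 0 \<le> x \<bullet> (Psi P \<psi> *v x)" and pos: "0 < \<psi> $ e"
    using \<psi> by (auto simp: param_set_def pos_semidef_def)
  have t1: "transpose (c *\<^sub>R mat 1) = (c *\<^sub>R mat 1 :: real ^ 'n ^ 'n)" for c
    by (simp add: transpose_def mat_def vec_eq_iff)
  have tV: "transpose ?V = ?V"
    by (simp add: cov_def transpose_add matrix_transpose_mul Psi matrix_mul_assoc t1)
  have q: "\<psi> $ e * (x \<bullet> x) \<le> x \<bullet> (?V *v x)" for x
  proof -
    have "?V *v x = Z *v (Psi P \<psi> *v (transpose Z *v x)) + \<psi> $ e *\<^sub>R x"
      by (simp add: cov_def matrix_vector_mult_add_rdistrib matrix_vector_mul_assoc matrix_mul_assoc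
          flip: scaleR_matrix_vector_assoc)
    then have "x \<bullet> (?V *v x) = (transpose Z *v x) \<bullet> (Psi P \<psi> *v (transpose Z *v x)) + \<psi> $ e * (x \<bullet> x)"
      using inner_matrix_vector_transpose[of x "transpose Z" "Psi P \<psi> *v (transpose Z *v x)"]
      by (simp add: inner_add_right)
    then show ?thesis using Psi(2)[of "transpose Z *v x"] by simp
  qed
  have "0 \<le> x \<bullet> (?V *v x)" for x using q[of x] pos by (smt (verit) inner_ge_zero mult_nonneg_nonneg)
  then show "pos_semidef ?V" using tV by (simp add: pos_semidef_def)
  have "x = 0" if "?V *v x = 0" for x
  proof -
    have "\<psi> $ e * (x \<bullet> x) \<le> 0" using q[of x] that by simp
    then have "x \<bullet> x \<le> 0" using pos by (simp add: mult_le_0_iff)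
    then show ?thesis using inner_ge_zero[of x] inner_eq_zero_iff[of x] by linarith
  qed
  then obtain B where "B ** ?V = mat 1" using matrix_left_invertible_ker[of ?V] by blast
  then show "invertible ?V" using matrix_left_right_inverse[of B ?V] by (auto simp: invertible_def)
qed

lemma transpose_A_mat:
  assumes pat: "covariance_pattern P e" and \<psi>: "\<psi> \<in> param_set P e"
  shows "transpose (A_mat Z P e \<psi> j) = A_mat Z P e \<psi> j"
proof -
  have H: "transpose (H_mat P j) = H_mat P j"
    using pat by (simp add: covariance_pattern_def H_mat_def transpose_def vec_eq_iff)
  have "transpose (Z ** H_mat P j ** transpose Z + (if j = e then mat 1 else 0))
    = Z ** H_mat P j ** transpose Z + (if j = e then mat 1 else 0)"
    by (simp add: transpose_add matrix_transpose_mul H matrix_mul_assoc)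
      (simp add: transpose_def mat_def vec_eq_iff)
  then show ?thesis
    unfolding A_mat_def frechet_derivative_cov matrix_transpose_mul
      transpose_mat_inv_sqrt[OF cov_pos_semidef_invertible[OF \<psi>]]
    by (simp add: matrix_mul_assoc)
qed

lemma transpose_A_comb:
  assumes "covariance_pattern P e" and "\<psi> \<in> param_set P e"
  shows "transpose (A_comb Z P e v \<psi>) = A_comb Z P e v \<psi>"
  by (simp add: A_comb_def transpose_sum_scaleR transpose_A_mat[OF assms])

text \<open>The Fisher information is half the Gram matrix of the \<open>A\<^sub>j\<close> for the inner product \<open>tr (A B)\<close>, whose
  norm on symmetric matrices is the Frobenius norm. This makes it positive semi-definite, and it is the
  reason why \<open>A(v', \<psi>)\<close> has a known Frobenius norm.\<close>

lemma fisher_info_quadratic_form: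
  assumes "covariance_pattern P e" and "\<psi> \<in> param_set P e"
  shows "v \<bullet> (fisher_info Z P e \<psi> *v v) = (frobenius_norm (A_comb Z P e v \<psi>))\<^sup>2 / 2"
proof -
  have "fisher_info Z P e \<psi> = (1 / 2) *\<^sub>R (\<chi> i j. trace (A_mat Z P e \<psi> i ** A_mat Z P e \<psi> j))"
    by (simp add: fisher_info_def vec_eq_iff)
  then have "v \<bullet> (fisher_info Z P e \<psi> *v v)
    = 1 / 2 * (v \<bullet> ((\<chi> i j. trace (A_mat Z P e \<psi> i ** A_mat Z P e \<psi> j)) *v v))"
    by (simp flip: scaleR_matrix_vector_assoc)
  then show ?thesis
    by (simp add: frobenius_norm_sq_trace transpose_A_comb[OF assms])
      (simp add: A_comb_def trace_sum_scaleR_mult)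
qed

lemma pos_semidef_fisher_info:
  assumes "covariance_pattern P e" and "\<psi> \<in> param_set P e"
  shows "pos_semidef (fisher_info Z P e \<psi>)"
  unfolding pos_semidef_def fisher_info_quadratic_form[OF assms]
  by (auto simp: fisher_info_def transpose_def vec_eq_iff intro: trace_mul_sym)

lemma inner_score:
  "v \<bullet> score Z P e \<psi> y = (let R = mat_inv_sqrt (cov Z P e \<psi>) *v y; A = A_comb Z P e v \<psi>
    in (R \<bullet> (A *v R) - trace A) / 2)"
  by (simp add: score_def Let_def A_comb_def inner_vec_def[of v] trace_sum_scaleR sum_scaleR_matrix_vector
      inner_sum_right right_diff_distrib sum_subtractf sum_divide_distrib[symmetric] diff_divide_distrib)

text \<open>The set where the functions differ is open, and a non-empty open set is not a null set.\<close>

lemma continuous_AE_eq_imp_eq: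
  fixes f g :: "real \<Rightarrow> real"
  assumes f: "continuous_on UNIV f" and g: "continuous_on UNIV g" and eq: "AE x in lborel. f x = g x"
  shows "f = g"
proof (rule ccontr)
  let ?S = "{x. f x \<noteq> g x}"
  assume "f \<noteq> g"
  then have ne: "?S \<noteq> {}" by auto
  have op: "open ?S" using open_Collect_neq[OF f g] .
  then have "?S \<in> null_sets lborel" using eq by (subst (asm) AE_iff_null) auto
  then have "negligible ?S" by (simp add: negligible_iff_null_sets null_sets_completionI)
  then show False using open_not_negligible[OF op ne] by simp
qed

lemma continuous_density_unique:
  assumes f: "continuous_density M X f" and g: "continuous_density M X g"
  shows "f = g"
proof (rule continuous_AE_eq_imp_eq)
  show cf: "continuous_on UNIV f" and cg: "continuous_on UNIV g" using f g by (auto simp: continuous_density_def)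
  have "density lborel (\<lambda>x. ennreal (f x)) = density lborel (\<lambda>x. ennreal (g x))"
    using f g by (auto simp: continuous_density_def distributed_def)
  moreover have "f \<in> borel_measurable borel" "g \<in> borel_measurable borel"
    using cf cg by (auto intro: borel_measurable_continuous_onI)
  ultimately have "AE x in lborel. ennreal (f x) = ennreal (g x)"
    by (subst (asm) sigma_finite_measure.density_unique_iff[OF sigma_finite_lborel]) simp_all
  then show "AE x in lborel. f x = g x" using f g by (auto simp: continuous_density_def)
qed

lemma integrable_iexp_half_square:
  "integrable std_normal_distribution (\<lambda>x. iexp (t * ((x\<^sup>2 - 1) / 2)))"
proof -
  interpret N: real_distribution std_normal_distribution by (rule real_dist_normal_dist)
  show ?thesis by (rule N.integrable_const_bound[where B = 1]) auto
qed

text \<open>The coordinates of \<open>X\<close> are independent, so the expectation factorizes.\<close>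

lemma char_quadratic_form:
  fixes l :: "'n::finite \<Rightarrow> real" and X :: "'a \<Rightarrow> real ^ 'n"
  assumes X: "X \<in> borel_measurable M" and dist: "distr M borel X = std_gaussian"
  shows "char (distr M borel (\<lambda>\<omega>. \<Sum>i\<in>UNIV. l i * (((X \<omega> $ i)\<^sup>2 - 1) / 2))) = quad_char l"
proof
  fix s
  note [measurable] = X
  have "(\<lambda>x :: real ^ 'n. x $ i) \<in> borel_measurable borel" for i
    by (intro borel_measurable_continuous_onI continuous_intros)
  from measurable_compose[OF X this] have [measurable]: "(\<lambda>\<omega>. X \<omega> $ i) \<in> borel_measurable M" for i .
  have "char (distr M borel (\<lambda>\<omega>. \<Sum>i\<in>UNIV. l i * (((X \<omega> $ i)\<^sup>2 - 1) / 2))) s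
    = (\<integral>\<omega>. iexp (s * (\<Sum>i\<in>UNIV. l i * (((X \<omega> $ i)\<^sup>2 - 1) / 2))) \<partial>M)"
    unfolding char_def by (rule integral_distr) auto
  also have "\<dots> = (\<integral>\<omega>. (\<Prod>i\<in>UNIV. iexp (l i * s * (((X \<omega> $ i)\<^sup>2 - 1) / 2))) \<partial>M)"
    by (intro Bochner_Integration.integral_cong)
      (simp_all add: exp_sum[symmetric] sum_distrib_left mult_ac)
  also have "\<dots> = (\<integral>x. (\<Prod>i\<in>UNIV. iexp (l i * s * (((x $ i)\<^sup>2 - 1) / 2))) \<partial>distr M borel X)"
    by (rule integral_distr[symmetric])
      (auto intro!: borel_measurable_continuous_onI continuous_intros)
  also have "\<dots> = (\<Prod>i\<in>UNIV. \<integral>x. iexp (l i * s * ((x\<^sup>2 - 1) / 2)) \<partial>std_normal_distribution)"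
    unfolding dist by (rule integral_std_gaussian_prod_vec) (rule integrable_iexp_half_square)
  also have "\<dots> = quad_char l s"
    unfolding quad_char_def expectation_iexp_half_square ..
  finally show "char (distr M borel (\<lambda>\<omega>. \<Sum>i\<in>UNIV. l i * (((X \<omega> $ i)\<^sup>2 - 1) / 2))) s = quad_char l s" .
qed

section \<open>Normal approximation of the standardized score\<close>

theorem lemma4:
  fixes M :: "'a measure"
    and Y :: "'a \<Rightarrow> real ^ 'n"
    and Z :: "real ^ 'q ^ 'n"
    and P :: "'q \<Rightarrow> 'q \<Rightarrow> 'r::finite option"
    and e :: 'r
    and \<psi> v v' :: "real ^ 'r"
  assumes "covariance_pattern P e"
    and "\<psi> \<in> param_set P e"
    and "prob_space M"
    and "distributed M lborel Y (\<lambda>y. ennreal (mvn_density 0 (cov Z P e \<psi>) y))"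
    and "invertible (fisher_info Z P e \<psi>)"
    and "v \<in> sphere 0 1"
    and "v' = mat_inv_sqrt (fisher_info Z P e \<psi>) *v v"
    and "v' \<noteq> 0"
    and "(a_ratio Z P e v' \<psi>)\<^sup>2 < 1 / 8"
  shows "(\<exists>g. continuous_density M (\<lambda>\<omega>. v \<bullet> std_score Z P e \<psi> (Y \<omega>)) g) \<and>
    (\<forall>g. continuous_density M (\<lambda>\<omega>. v \<bullet> std_score Z P e \<psi> (Y \<omega>)) g \<longrightarrow>
      (\<forall>t. \<bar>g t - std_normal_density t\<bar> \<le>
        0.14 * (4 + 0.29 / (1 - 8 * (a_ratio Z P e v' \<psi>)\<^sup>2)\<^sup>2) * a_ratio Z P e v' \<psi>))"
proof -
  let ?V = "cov Z P e \<psi>" and ?I = "fisher_info Z P e \<psi>" and ?A = "A_comb Z P e v' \<psi>"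
  let ?a = "a_ratio Z P e v' \<psi>" and ?S = "\<lambda>\<omega>. v \<bullet> std_score Z P e \<psi> (Y \<omega>)"
  define W where "W = mat_inv_sqrt ?V"
  define J where "J = mat_inv_sqrt ?I"
  interpret prob_space M by fact
  note V = cov_pos_semidef_invertible[OF assms(2), of Z]
  note I = pos_semidef_fisher_info[OF assms(1,2), of Z] assms(5)
  have v': "v' = J *v v" using assms(7) by (simp add: J_def)
  have J: "transpose J = J" "J ** ?I ** J = mat 1"
    using transpose_mat_inv_sqrt[OF I] mat_inv_sqrt_conjugate[OF I] by (simp_all add: J_def)
  \<comment> \<open>The statistic has unit variance: \<open>v'\<close> has length one in the metric given by the Fisher information.\<close>
  have frob: "(frobenius_norm ?A)\<^sup>2 = 2"
  proof -
    have "v' \<bullet> (?I *v v') = v \<bullet> ((J ** ?I ** J) *v v)"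
      using symmetric_inner_commute[OF J(1), of v "?I *v (J *v v)"]
      by (simp add: v' matrix_vector_mul_assoc matrix_mul_assoc)
    also have "\<dots> = 1" using assms(6) J(2) by (simp add: dot_square_norm)
    finally show ?thesis using fisher_info_quadratic_form[OF assms(1,2), of v' Z] by simp
  qed
  obtain Q l where Q: "orthogonal_matrix Q" and A: "?A = transpose Q ** diag_mat l ** Q"
    using symmetric_matrix_diagonalization[OF transpose_A_comb[OF assms(1,2)]] by blast
  have l2: "(\<Sum>i\<in>UNIV. (l i)\<^sup>2) = 2"
    using frob unfolding A frobenius_norm_sq_trace transpose_orthogonal_conjugate
    by (simp add: orthogonal_conjugate_mult[OF Q] trace_orthogonal_conjugate[OF Q] power2_eq_square)
  have frob': "frobenius_norm ?A = sqrt 2"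
    using frob by (simp add: frobenius_norm_def real_sqrt_unique)
  then have a: "?a = spectral_norm ?A / sqrt 2" by (simp add: a_ratio_def)
  have la: "(l i)\<^sup>2 \<le> 2 * ?a\<^sup>2" for i
  proof -
    have "\<bar>l i\<bar> \<le> spectral_norm ?A" unfolding A by (rule abs_eigenvalue_le_spectral_norm[OF Q])
    then have "(l i)\<^sup>2 \<le> (spectral_norm ?A)\<^sup>2" using abs_le_square_iff by fastforce
    then show ?thesis by (simp add: a power_divide)
  qed
  have "0 \<le> ?a" unfolding a spectral_norm_def
    by (intro divide_nonneg_nonneg onorm_pos_le matrix_vector_mul_bounded_linear) simp
  moreover have "?a \<noteq> 0"
  proof
    assume "?a = 0"
    then have "l i = 0" for i using la[of i] by simp
    then show False using l2 by simp
  qed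
  ultimately have a_pos: "0 < ?a" by simp
  \<comment> \<open>The standardized observation \<open>R = W *v Y\<close> in the eigenbasis of \<open>A\<close>.\<close>
  define X where "X \<omega> = (Q ** W) *v Y \<omega>" for \<omega>
  have Wt: "transpose W = W" and WW: "W ** W = matrix_inv ?V" and iW: "invertible W"
    using transpose_mat_inv_sqrt[OF V] mat_inv_sqrt_mult[OF V] invertible_mat_inv_sqrt[OF V] by (simp_all add: W_def)
  have normL: "(norm ((Q ** W) *v y))\<^sup>2 = y \<bullet> (matrix_inv ?V *v y)" for y
  proof -
    have "(norm ((Q ** W) *v y))\<^sup>2 = (Q *v (W *v y)) \<bullet> (Q *v (W *v y))"
      by (simp add: power2_norm_eq_inner matrix_vector_mul_assoc)
    also have "\<dots> = (W *v y) \<bullet> (transpose Q *v (Q *v (W *v y)))"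
      by (rule inner_matrix_vector_transpose[symmetric])
    also have "\<dots> = y \<bullet> (W *v (W *v y))"
      by (simp add: orthogonal_matrix_cancel[OF Q] symmetric_inner_commute[OF Wt])
    finally show ?thesis by (simp add: matrix_vector_mul_assoc WW)
  qed
  have X_dist: "distr M borel X = std_gaussian"
    unfolding X_def[abs_def]
  proof (rule distr_linear_std_gaussian[OF assms(3), where L = "(*v) (Q ** W)" and Y = Y])
    show "distributed M lborel Y (\<lambda>y. ennreal (1 / sqrt ((2 * pi) ^ CARD('n) * det ?V) * exp (- (norm ((Q ** W) *v y))\<^sup>2 / 2)))"
      using assms(4) by (simp add: mvn_density_def normL)
    show "linear ((*v) (Q ** W))" by (rule matrix_vector_mul_linear)
    have "invertible Q" using Q by (auto simp: orthogonal_matrix_def invertible_def)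
    then have "invertible (Q ** W)" using iW by (rule invertible_mult)
    then obtain B where "(Q ** W) ** B = mat 1" by (auto simp: invertible_def)
    then show "surj ((*v) (Q ** W))" using matrix_right_invertible_surjective by blast
  qed
  have Y_meas: "Y \<in> borel_measurable M" using distributed_measurable[OF assms(4)] by simp
  have X_meas: "X \<in> borel_measurable M"
    unfolding X_def[abs_def] using Y_meas
    by (rule borel_measurable_continuous_on[rotated])
      (intro linear_continuous_on matrix_vector_mul_bounded_linear)
  have S: "?S \<omega> = (\<Sum>i\<in>UNIV. l i * (((X \<omega> $ i)\<^sup>2 - 1) / 2))" for \<omega>
  proof -
    have "?S \<omega> = v' \<bullet> score Z P e \<psi> (Y \<omega>)"
      using symmetric_inner_commute[OF J(1), of v] by (simp add: std_score_def v' J_def)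
    also have "\<dots> = ((\<Sum>i\<in>UNIV. l i * (X \<omega> $ i)\<^sup>2) - (\<Sum>i\<in>UNIV. l i)) / 2"
      unfolding inner_score Let_def A quadratic_form_conjugate trace_orthogonal_conjugate[OF Q]
      by (simp add: X_def W_def matrix_vector_mul_assoc)
    also have "\<dots> = (\<Sum>i\<in>UNIV. l i * (((X \<omega> $ i)\<^sup>2 - 1) / 2))"
      by (simp add: sum_subtractf sum_divide_distrib right_diff_distrib diff_divide_distrib)
    finally show ?thesis .
  qed
  have S_meas [measurable]: "?S \<in> borel_measurable M"
  proof -
    have "(\<lambda>x :: real ^ 'n. \<Sum>i\<in>UNIV. l i * (((x $ i)\<^sup>2 - 1) / 2)) \<in> borel_measurable borel"
      by (intro borel_measurable_continuous_onI continuous_intros) simp_all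
    from measurable_compose[OF X_meas this] show ?thesis unfolding S .
  qed
  define D where "D = distr M borel ?S"
  interpret D: real_distribution D unfolding D_def by (rule real_distribution_distr) simp
  have char: "char D = quad_char l" unfolding D_def S by (rule char_quadratic_form[OF X_meas X_dist])
  note bound = D.quad_char_density_bound[OF char l2 a_pos assms(9) la]
  let ?g = "\<lambda>t. Re (D.inverse_fourier t)"
  have "continuous_density M ?S ?g"
    unfolding continuous_density_def
  proof (intro conjI allI)
    show cont: "continuous_on UNIV ?g"
      by (intro continuous_at_imp_continuous_on ballI isCont_Re D.isCont_inverse_fourier bound)
    show "0 \<le> ?g t" for t by (intro D.Re_inverse_fourier_nonneg bound)
    show "distributed M lborel ?S (\<lambda>t. ennreal (?g t))"
      unfolding distributed_def
    proof (intro conjI)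
      have "distr M lborel ?S = D" unfolding D_def by (rule distr_cong) simp_all
      then show "distr M lborel ?S = density lborel (\<lambda>t. ennreal (?g t))"
        using D.density_inverse_fourier[OF bound(1)] by simp
      show "(\<lambda>t. ennreal (?g t)) \<in> borel_measurable lborel"
        using borel_measurable_continuous_onI[OF cont] by simp
    qed simp
  qed
  then show ?thesis using continuous_density_unique bound(2) by blast
qed

end
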